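(* Let $G_\bullet$ be a strict Lie $2$-group. The map $\varepsilon_\bullet:W_\bullet G\to W_\bullet(\mathrm{Dec}\,G)$ given by the recursive formula $$\varepsilon_0(g)=s_0(g),\qquad\varepsilon_1(\gamma;g)=\big(s_0\gamma;\ \gamma^{-1}\cdot s_0d_0(\gamma)\cdot s_0(g)\big),$$ $$\varepsilon_p=\Big(s_0\circ\mathrm{pr}_p;\ \big(\bar\partial_0^{\mathrm{dec}}\circ\varepsilon_1\circ\partial_2\circ\cdots\circ\partial_p,\ \mathrm{pr}_{p-1}\big);\ \bar\partial_0^{\mathrm{dec}}\circ\varepsilon_{p-1}\circ\partial_0\Big)\qquad(p\ge2),$$ where $\mathrm{pr}_j:W_pG\to G_j$ denotes the natural projection, is a (well-defined) simplicial map and a splitting of $Wd_0:W_\bullet(\mathrm{Dec}\,G)\to W_\bullet G$, i.e. $Wd_0\circ\varepsilon=\mathrm{id}$.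
   Context: A strict Lie $2$-group $G_\bullet$ is a simplicial Lie group (faces $d_i$, degeneracies $s_i$) whose underlying simplicial manifold is the nerve of a Lie groupoid $G_1\rightrightarrows G_0$ with source $d_0$ and target $d_1$. The group multiplication in each $G_n$ is written $\gamma\cdot\gamma'$, with inverse $\gamma^{-1}$; the groupoid multiplication $\gamma_1\Join\gamma_2$ is defined when $d_0\gamma_1=d_1\gamma_2$. Elements of $G_n$ ($n\ge1$) are $n$-tuples $(\gamma_1,\dots,\gamma_n)\in G_1^n$ with $d_0\gamma_i=d_1\gamma_{i+1}$; $d_0$ drops $\gamma_1$, $d_n$ drops $\gamma_n$, the other $d_i$ replace $\gamma_i,\gamma_{i+1}$ by $\gamma_i\Join\gamma_{i+1}$. In the formula for $\varepsilon_p$, the pair $(a,\gamma')$ with $a\in G_1$, $\gamma'\in G_{p-1}$ is regarded as an element of $G_p$. For a simplicial object $X_\bullet$, the décalage is $\mathrm{Dec}_n(X)=X_{n+1}$ with $d_k^{\mathrm{Dec}}=d_{k+1}$, $s_k^{\mathrm{Dec}}=s_{k+1}$ for $0\le k\le n$. For a simplicial group $K_\bullet$: $\overline W_0K=pt$, $\overline W_{n+1}K=K_n\times\cdots\times K_0$, with faces $\bar\partial_0(\gamma^n;\dots;\gamma^0)=(\gamma^{n-1};\dots;\gamma^0)$, $\bar\partial_i(\gamma^n;\dots;\gamma^0)=(d_{i-1}\gamma^n;\dots;d_1\gamma^{n-i+2};(d_0\gamma^{n-i+1})\gamma^{n-i};\gamma^{n-i-1};\dots;\gamma^0)$ for $0<i\le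 n$, $\bar\partial_{n+1}(\gamma^n;\dots;\gamma^0)=(d_n\gamma^n;\dots;d_1\gamma^1)$, and degeneracies $\bar\sigma_i(\gamma^n;\dots;\gamma^0)=(s_{i-1}\gamma^n;\dots;s_0\gamma^{n+1-i};1;\gamma^{n-i};\dots;\gamma^0)$. Put $W_\bullet K:=\mathrm{Dec}_\bullet(\overline WK)$, so that $W_pK=\overline W_{p+1}K=K_p\times\cdots\times K_0$ with faces $\partial_i=\bar\partial_{i+1}$ and degeneracies $\sigma_i=\bar\sigma_{i+1}$, $0\le i\le p$. Applying this to the simplicial group $\mathrm{Dec}\,G$ gives $W_p(\mathrm{Dec}\,G)=G_{p+1}\times\cdots\times G_1$, whose structure maps carry the superscript "dec"; $\bar\partial_0^{\mathrm{dec}}:W_p(\mathrm{Dec}\,G)\to\overline W_p(\mathrm{Dec}\,G)=G_p\times\cdots\times G_1$ drops the first factor. The map $d_0:\mathrm{Dec}_\bullet(G)\to G_\bullet$ is simplicial and $Wd_0$ applies it to each factor. *)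

theory Defs
  imports "HOL-Analysis.Analysis" "HOL-Algebra.Group"
begin

section \<open>Smooth manifolds\<close>

text \<open>
  \<open>R\<^sup>m\<close> is the library space \<^const>\<open>Euclidean_space\<close>: functions \<open>nat \<Rightarrow> real\<close> vanishing from
  index \<open>m\<close> on. Unlike a \<open>euclidean_space\<close> type, this lets the dimension vary with the
  simplicial degree.
\<close>

primrec Ck :: "nat \<Rightarrow> nat \<Rightarrow> (nat \<Rightarrow> real) set \<Rightarrow> ((nat \<Rightarrow> real) \<Rightarrow> real) \<Rightarrow> bool" where
  "Ck 0 m U f \<longleftrightarrow> continuous_map (subtopology (Euclidean_space m) U) euclideanreal f"
| "Ck (Suc k) m U f \<longleftrightarrow>
     continuous_map (subtopology (Euclidean_space m) U) euclideanreal f \<and>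
     (\<forall>i<m. \<exists>g. (\<forall>x\<in>U. ((\<lambda>t. f (x(i := t))) has_real_derivative g x) (at (x i))) \<and> Ck k m U g)"

definition smooth_coords ::
    "nat \<Rightarrow> (nat \<Rightarrow> real) set \<Rightarrow> nat \<Rightarrow> ((nat \<Rightarrow> real) \<Rightarrow> (nat \<Rightarrow> real)) \<Rightarrow> bool" where
  "smooth_coords m U n F \<longleftrightarrow> (\<forall>j<n. \<forall>k. Ck k m U (\<lambda>x. F x j))"

record 'a manifold =
  mtop :: "'a topology"
  mdim :: nat
  atlas :: "('a set \<times> ('a \<Rightarrow> nat \<Rightarrow> real)) set"

abbreviation points :: "'a manifold \<Rightarrow> 'a set" where
  "points M \<equiv> topspace (mtop M)"

definition chart :: "'a manifold \<Rightarrow> 'a set \<Rightarrow> ('a \<Rightarrow> nat \<Rightarrow> real) \<Rightarrow> bool" where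
  "chart M U \<phi> \<longleftrightarrow>
     openin (mtop M) U \<and> openin (Euclidean_space (mdim M)) (\<phi> ` U) \<and>
     homeomorphic_map (subtopology (mtop M) U)
       (subtopology (Euclidean_space (mdim M)) (\<phi> ` U)) \<phi>"

text \<open>Membership in the maximal atlas determined by the given one.\<close>
definition smooth_chart :: "'a manifold \<Rightarrow> 'a set \<Rightarrow> ('a \<Rightarrow> nat \<Rightarrow> real) \<Rightarrow> bool" where
  "smooth_chart M U \<phi> \<longleftrightarrow>
     chart M U \<phi> \<and>
     (\<forall>(V, \<psi>) \<in> atlas M.
        smooth_coords (mdim M) (\<phi> ` (U \<inter> V)) (mdim M) (\<lambda>y. \<psi> (inv_into U \<phi> y)) \<and>
        smooth_coords (mdim M) (\<psi> ` (U \<inter> V)) (mdim M) (\<lambda>y. \<phi> (inv_into V \<psi> y)))"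

definition smooth_manifold :: "'a manifold \<Rightarrow> bool" where
  "smooth_manifold M \<longleftrightarrow>
     Hausdorff_space (mtop M) \<and> second_countable (mtop M) \<and>
     (\<Union>(U, \<phi>) \<in> atlas M. U) = points M \<and>
     (\<forall>(U, \<phi>) \<in> atlas M. smooth_chart M U \<phi>)"

definition smooth_map :: "'a manifold \<Rightarrow> 'b manifold \<Rightarrow> ('a \<Rightarrow> 'b) \<Rightarrow> bool" where
  "smooth_map M N f \<longleftrightarrow>
     continuous_map (mtop M) (mtop N) f \<and>
     (\<forall>(U, \<phi>) \<in> atlas M. \<forall>(V, \<psi>) \<in> atlas N.
        smooth_coords (mdim M) (\<phi> ` {x \<in> U. f x \<in> V}) (mdim N) (\<lambda>y. \<psi> (f (inv_into U \<phi> y))))"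

text \<open>The Jacobian has full row rank at every point.\<close>
definition submersion :: "'a manifold \<Rightarrow> 'b manifold \<Rightarrow> ('a \<Rightarrow> 'b) \<Rightarrow> bool" where
  "submersion M N f \<longleftrightarrow>
     smooth_map M N f \<and>
     (\<forall>(U, \<phi>) \<in> atlas M. \<forall>(V, \<psi>) \<in> atlas N. \<forall>x\<in>U. f x \<in> V \<longrightarrow>
        (let J = (\<lambda>i j. deriv (\<lambda>t. \<psi> (f (inv_into U \<phi> ((\<phi> x)(j := t)))) i) (\<phi> x j))
         in \<forall>w. \<exists>v. \<forall>i<mdim N. (\<Sum>j<mdim M. J i j * v j) = w i))"

text \<open>
  The topological embedding \<open>f\<close> identifies \<open>N\<close> with an embedded submanifold of \<open>M\<close>: around each
  point of the image there is a slice chart of \<open>M\<close>, whose restriction is a chart of \<open>N\<close>.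
\<close>
definition submanifold_embedding :: "'a manifold \<Rightarrow> 'b manifold \<Rightarrow> ('a \<Rightarrow> 'b) \<Rightarrow> bool" where
  "submanifold_embedding N M f \<longleftrightarrow>
     embedding_map (mtop N) (mtop M) f \<and>
     (\<forall>p\<in>points N. \<exists>U \<phi>. smooth_chart M U \<phi> \<and> f p \<in> U \<and>
        \<phi> ` (U \<inter> f ` points N) = {y \<in> \<phi> ` U. \<forall>i\<ge>mdim N. y i = 0} \<and>
        smooth_chart N {x \<in> points N. f x \<in> U} (\<lambda>x. \<phi> (f x)))"

text \<open>
  Finite products over an index set of naturals. A tuple is an extensional function; product charts
  concatenate coordinates, the block of factor \<open>i\<close> starting at \<open>offset i\<close>.
\<close>
definition product_manifold :: "nat set \<Rightarrow> (nat \<Rightarrow> 'a manifold) \<Rightarrow> (nat \<Rightarrow> 'a) manifold" where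
  "product_manifold I M =
     (let offset = (\<lambda>i. \<Sum>l\<in>{l\<in>I. l < i}. mdim (M l)) in
      \<lparr> mtop = product_topology (\<lambda>i. mtop (M i)) I,
        mdim = (\<Sum>i\<in>I. mdim (M i)),
        atlas = {(\<Pi>\<^sub>E i\<in>I. U i,
                  \<lambda>x r. \<Sum>i\<in>I. if offset i \<le> r \<and> r < offset i + mdim (M i)
                                then \<phi> i (x i) (r - offset i) else 0) | U \<phi>.
                 \<forall>i\<in>I. (U i, \<phi> i) \<in> atlas (M i)} \<rparr>)"


section \<open>Lie groups and Lie groupoids\<close>

record 'a Lie_group_data = "'a monoid" +
  mfd :: "'a manifold"

definition Lie_group :: "'a Lie_group_data \<Rightarrow> bool" where
  "Lie_group L \<longleftrightarrow>
     group L \<and> smooth_manifold (mfd L) \<and> points (mfd L) = carrier L \<and>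
     smooth_map (product_manifold {0, 1} (\<lambda>_. mfd L)) (mfd L) (\<lambda>z. z 0 \<otimes>\<^bsub>L\<^esub> z 1) \<and>
     smooth_map (mfd L) (mfd L) (\<lambda>x. inv\<^bsub>L\<^esub> x)"

text \<open>Tuples \<open>(\<gamma>\<^sub>1, \<dots>, \<gamma>\<^sub>n)\<close> of arrows are functions on \<open>{1..n}\<close>.\<close>
definition composable :: "'x set \<Rightarrow> ('x \<Rightarrow> 'x) \<Rightarrow> ('x \<Rightarrow> 'x) \<Rightarrow> nat \<Rightarrow> (nat \<Rightarrow> 'x) set" where
  "composable A src tgt n =
     {\<gamma> \<in> {1..n} \<rightarrow>\<^sub>E A. \<forall>i\<in>{1..<n}. src (\<gamma> i) = tgt (\<gamma> (Suc i))}"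

text \<open>
  \<open>P\<close> below is the fibre product of \<open>src\<close> and \<open>tgt\<close>, an embedded submanifold of the square of
  the arrow manifold. Its smooth structure is determined by \<^const>\<open>submanifold_embedding\<close>.
\<close>
definition Lie_groupoid ::
    "'x manifold \<Rightarrow> 'x manifold \<Rightarrow> ('x \<Rightarrow> 'x) \<Rightarrow> ('x \<Rightarrow> 'x) \<Rightarrow> ('x \<Rightarrow> 'x) \<Rightarrow> ('x \<Rightarrow> 'x \<Rightarrow> 'x) \<Rightarrow> bool"
  where
  "Lie_groupoid M0 M1 src tgt unit gmult \<longleftrightarrow>
     smooth_manifold M0 \<and> smooth_manifold M1 \<and>
     submersion M1 M0 src \<and> submersion M1 M0 tgt \<and> smooth_map M0 M1 unit \<and>
     (\<exists>P. smooth_manifold P \<and> points P = composable (points M1) src tgt 2 \<and>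
          submanifold_embedding P (product_manifold {1..2} (\<lambda>_. M1)) (\<lambda>\<gamma>. \<gamma>) \<and>
          smooth_map P M1 (\<lambda>\<gamma>. gmult (\<gamma> 1) (\<gamma> 2))) \<and>
     (\<forall>a\<in>points M1. \<forall>b\<in>points M1. src a = tgt b \<longrightarrow>
        src (gmult a b) = src b \<and> tgt (gmult a b) = tgt a) \<and>
     (\<forall>a\<in>points M1. \<forall>b\<in>points M1. \<forall>c\<in>points M1. src a = tgt b \<and> src b = tgt c \<longrightarrow>
        gmult (gmult a b) c = gmult a (gmult b c)) \<and>
     (\<forall>x\<in>points M0. src (unit x) = x \<and> tgt (unit x) = x) \<and>
     (\<forall>a\<in>points M1. gmult a (unit (src a)) = a \<and> gmult (unit (tgt a)) a = a) \<and>
     (\<exists>ginv. smooth_map M1 M1 ginv \<and>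
        (\<forall>a\<in>points M1. src (ginv a) = tgt a \<and> tgt (ginv a) = src a \<and>
           gmult a (ginv a) = unit (tgt a) \<and> gmult (ginv a) a = unit (src a)))"


section \<open>Simplicial objects\<close>

text \<open>
  \<open>face X n i\<close> is \<open>d\<^sub>i : X\<^sub>n \<rightarrow> X\<^bsub>n-1\<^esub>\<close> (for \<open>n \<ge> 1\<close>, \<open>i \<le> n\<close>) and \<open>degen X n i\<close> is
  \<open>s\<^sub>i : X\<^sub>n \<rightarrow> X\<^bsub>n+1\<^esub>\<close> (for \<open>i \<le> n\<close>); both are irrelevant outside these ranges. The type
  \<open>'l\<close> of levels is a manifold or a Lie group on the element type \<open>'x\<close>; one element type serves
  all levels, whose carriers need not be disjoint.
\<close>
record ('l, 'x) simplicial =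
  level :: "nat \<Rightarrow> 'l"
  face :: "nat \<Rightarrow> nat \<Rightarrow> 'x \<Rightarrow> 'x"
  degen :: "nat \<Rightarrow> nat \<Rightarrow> 'x \<Rightarrow> 'x"

type_synonym 'x simplicial_manifold = "('x manifold, 'x) simplicial"
type_synonym 'x simplicial_Lie_group = "('x Lie_group_data, 'x) simplicial"

definition simplicial_identities ::
    "(nat \<Rightarrow> 'x set) \<Rightarrow> (nat \<Rightarrow> nat \<Rightarrow> 'x \<Rightarrow> 'x) \<Rightarrow> (nat \<Rightarrow> nat \<Rightarrow> 'x \<Rightarrow> 'x) \<Rightarrow> bool" where
  "simplicial_identities C d s \<longleftrightarrow>
     (\<forall>n i j. \<forall>x\<in>C (n + 2). i < j \<and> j \<le> n + 2 \<longrightarrow>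
        d (n + 1) i (d (n + 2) j x) = d (n + 1) (j - 1) (d (n + 2) i x)) \<and>
     (\<forall>n i j. \<forall>x\<in>C n. i \<le> j \<and> j \<le> n \<longrightarrow>
        s (n + 1) i (s n j x) = s (n + 1) (j + 1) (s n i x)) \<and>
     (\<forall>n i j. \<forall>x\<in>C n. i < j \<and> j \<le> n \<longrightarrow>
        d (n + 1) i (s n j x) = s (n - 1) (j - 1) (d n i x)) \<and>
     (\<forall>n j. \<forall>x\<in>C n. j \<le> n \<longrightarrow> d (n + 1) j (s n j x) = x \<and> d (n + 1) (j + 1) (s n j x) = x) \<and>
     (\<forall>n i j. \<forall>x\<in>C n. j + 1 < i \<and> i \<le> n + 1 \<longrightarrow>
        d (n + 1) i (s n j x) = s (n - 1) j (d n (i - 1) x))"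

definition simplicial_Lie_group :: "'x simplicial_Lie_group \<Rightarrow> bool" where
  "simplicial_Lie_group K \<longleftrightarrow>
     (\<forall>n. Lie_group (level K n)) \<and>
     (\<forall>n i. i \<le> n + 1 \<longrightarrow>
        face K (n + 1) i \<in> hom (level K (n + 1)) (level K n) \<and>
        smooth_map (mfd (level K (n + 1))) (mfd (level K n)) (face K (n + 1) i)) \<and>
     (\<forall>n i. i \<le> n \<longrightarrow>
        degen K n i \<in> hom (level K n) (level K (n + 1)) \<and>
        smooth_map (mfd (level K n)) (mfd (level K (n + 1))) (degen K n i)) \<and>
     simplicial_identities (\<lambda>n. carrier (level K n)) (face K) (degen K)"

definition underlying_manifold :: "'x simplicial_Lie_group \<Rightarrow> 'x simplicial_manifold" where
  "underlying_manifold K = \<lparr> level = (\<lambda>n. mfd (level K n)), face = face K, degen = degen K \<rparr>"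

text \<open>A morphism of simplicial manifolds.\<close>
definition simplicial_map ::
    "'x simplicial_manifold \<Rightarrow> 'y simplicial_manifold \<Rightarrow> (nat \<Rightarrow> 'x \<Rightarrow> 'y) \<Rightarrow> bool" where
  "simplicial_map X Y f \<longleftrightarrow>
     (\<forall>n. smooth_map (level X n) (level Y n) (f n)) \<and>
     (\<forall>n i. \<forall>x\<in>points (level X (n + 1)). i \<le> n + 1 \<longrightarrow>
        f n (face X (n + 1) i x) = face Y (n + 1) i (f (n + 1) x)) \<and>
     (\<forall>n i. \<forall>x\<in>points (level X n). i \<le> n \<longrightarrow>
        f (n + 1) (degen X n i x) = degen Y n i (f n x))"


section \<open>Strict Lie 2-groups\<close>

text \<open>
  \<open>X\<close> is the nerve of the Lie groupoid with objects \<open>X\<^sub>0\<close>, arrows \<open>X\<^sub>1\<close>, source \<open>d\<^sub>0\<close>, target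
  \<open>d\<^sub>1\<close>, units \<open>s\<^sub>0\<close> and multiplication \<open>gmult\<close>. For \<open>n \<ge> 1\<close> the map \<open>tup n\<close> is the
  identification of \<open>X\<^sub>n\<close> with the manifold of composable \<open>n\<close>-tuples of arrows (it is forced by
  the face formulas). The \<open>k\<close>-th degeneracy inserts a unit at the \<open>k\<close>-th vertex,
  the vertices being \<open>d\<^sub>1 \<gamma>\<^sub>1, d\<^sub>0 \<gamma>\<^sub>1, \<dots>, d\<^sub>0 \<gamma>\<^sub>n\<close>.
\<close>
definition is_nerve ::
    "'x simplicial_manifold \<Rightarrow> ('x \<Rightarrow> 'x \<Rightarrow> 'x) \<Rightarrow> (nat \<Rightarrow> 'x \<Rightarrow> nat \<Rightarrow> 'x) \<Rightarrow> bool" where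
  "is_nerve X gmult tup \<longleftrightarrow>
     Lie_groupoid (level X 0) (level X 1) (face X 1 0) (face X 1 1) (degen X 0 0) gmult \<and>
     (\<forall>x\<in>points (level X 1). tup 1 x = (\<lambda>i\<in>{1}. x)) \<and>
     (\<forall>n\<ge>1. tup n ` points (level X n)
                = composable (points (level X 1)) (face X 1 0) (face X 1 1) n \<and>
             submanifold_embedding (level X n) (product_manifold {1..n} (\<lambda>_. level X 1)) (tup n)) \<and>
     (\<forall>n\<ge>2. \<forall>x\<in>points (level X n).
        tup (n - 1) (face X n 0 x) = (\<lambda>i\<in>{1..n - 1}. tup n x (i + 1)) \<and>
        tup (n - 1) (face X n n x) = (\<lambda>i\<in>{1..n - 1}. tup n x i) \<and>
        (\<forall>k\<in>{1..<n}. tup (n - 1) (face X n k x) =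
           (\<lambda>i\<in>{1..n - 1}. if i < k then tup n x i
                          else if i = k then gmult (tup n x k) (tup n x (k + 1))
                          else tup n x (i + 1)))) \<and>
     (\<forall>n\<ge>1. \<forall>x\<in>points (level X n). \<forall>k\<le>n.
        tup (n + 1) (degen X n k x) =
          (\<lambda>i\<in>{1..n + 1}. if i \<le> k then tup n x i
                         else if i = k + 1
                         then degen X 0 0 (if k = 0 then face X 1 1 (tup n x 1)
                                           else face X 1 0 (tup n x k))
                         else tup n x (i - 1)))"

definition strict_Lie_2_group ::
    "'x simplicial_Lie_group \<Rightarrow> ('x \<Rightarrow> 'x \<Rightarrow> 'x) \<Rightarrow> (nat \<Rightarrow> 'x \<Rightarrow> nat \<Rightarrow> 'x) \<Rightarrow> bool" where
  "strict_Lie_2_group G gmult tup \<longleftrightarrow>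
     simplicial_Lie_group G \<and> is_nerve (underlying_manifold G) gmult tup"


section \<open>Decalage and the W-constructions\<close>

definition Dec :: "('l, 'x) simplicial \<Rightarrow> ('l, 'x) simplicial" where
  "Dec X = \<lparr> level = (\<lambda>n. level X (n + 1)),
             face = (\<lambda>n k. face X (n + 1) (k + 1)),
             degen = (\<lambda>n k. degen X (n + 1) (k + 1)) \<rparr>"

text \<open>
  \<open>(\<gamma>\<^bsup>n-1\<^esup>; \<dots>; \<gamma>\<^sup>0)\<close> in \<open>Wbar\<^sub>n K = K\<^bsub>n-1\<^esub> \<times> \<cdots> \<times> K\<^sub>0\<close> is the function \<open>j \<mapsto> \<gamma>\<^sup>j\<close> on
  \<open>{..<n}\<close>; thus \<open>Wbar\<^sub>0 K\<close> is the empty product, a point. Beware that the usual formulas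
  describe the face \<open>i\<close> and the degeneracy \<open>i\<close> on degree \<open>n + 1\<close>, while \<open>n\<close> below is the
  degree itself.
\<close>
definition Wbar :: "'x simplicial_Lie_group \<Rightarrow> (nat \<Rightarrow> 'x) simplicial_manifold" where
  "Wbar K =
     \<lparr> level = (\<lambda>n. product_manifold {..<n} (\<lambda>j. mfd (level K j))),
       face = (\<lambda>n i \<gamma>. \<lambda>j\<in>{..<n - 1}.
         if i = 0 then \<gamma> j
         else if i = n then face K (j + 1) (j + 1) (\<gamma> (j + 1))
         else if j < n - 1 - i then \<gamma> j
         else if j = n - 1 - i then face K (j + 1) 0 (\<gamma> (j + 1)) \<otimes>\<^bsub>level K j\<^esub> \<gamma> j
         else face K (j + 1) (j - (n - 1 - i)) (\<gamma> (j + 1))),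
       degen = (\<lambda>n i \<gamma>. \<lambda>j\<in>{..<n + 1}.
         if j < n - i then \<gamma> j
         else if j = n - i then \<one>\<^bsub>level K j\<^esub>
         else degen K (j - 1) (j - (n - i) - 1) (\<gamma> (j - 1))) \<rparr>"

definition W :: "'x simplicial_Lie_group \<Rightarrow> (nat \<Rightarrow> 'x) simplicial_manifold" where
  "W K = Dec (Wbar K)"

definition W_map :: "(nat \<Rightarrow> 'x \<Rightarrow> 'y) \<Rightarrow> nat \<Rightarrow> (nat \<Rightarrow> 'x) \<Rightarrow> (nat \<Rightarrow> 'y)" where
  "W_map f p w = (\<lambda>j\<in>{..p}. f j (w j))"

text \<open>The simplicial map \<open>d\<^sub>0 : Dec G \<rightarrow> G\<close>.\<close>
definition Dec_d0 :: "('l, 'x) simplicial \<Rightarrow> nat \<Rightarrow> 'x \<Rightarrow> 'x" where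
  "Dec_d0 G n = face G (n + 1) 0"


section \<open>The map \<open>\<epsilon>\<close>\<close>

text \<open>The iterated face \<open>\<partial>\<^sub>2 \<circ> \<dots> \<circ> \<partial>\<^bsub>n+1\<^esub> : W\<^bsub>n+1\<^esub> G \<rightarrow> W\<^sub>1 G\<close>.\<close>
primrec faces_to_1 :: "'x simplicial_Lie_group \<Rightarrow> nat \<Rightarrow> (nat \<Rightarrow> 'x) \<Rightarrow> (nat \<Rightarrow> 'x)" where
  "faces_to_1 G 0 w = w"
| "faces_to_1 G (Suc n) w = faces_to_1 G n (face (W G) (n + 2) (n + 2) w)"

definition tuple_cons :: "nat \<Rightarrow> 'x \<Rightarrow> (nat \<Rightarrow> 'x) \<Rightarrow> (nat \<Rightarrow> 'x)" where
  "tuple_cons p a \<gamma> = (\<lambda>i\<in>{1..p}. if i = 1 then a else \<gamma> (i - 1))"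

text \<open>
  The pair \<open>(a, \<gamma>')\<close> with \<open>\<gamma>'\<close> in \<open>G\<^bsub>p-1\<^esub>\<close>, as an element of \<open>G\<^sub>p\<close>; meaningful only if
  the extended tuple is composable.
\<close>
definition cons_simplex ::
    "'x simplicial_Lie_group \<Rightarrow> (nat \<Rightarrow> 'x \<Rightarrow> nat \<Rightarrow> 'x) \<Rightarrow> nat \<Rightarrow> 'x \<Rightarrow> 'x \<Rightarrow> 'x" where
  "cons_simplex G tup p a \<gamma>' =
     inv_into (carrier (level G p)) (tup p) (tuple_cons p a (tup (p - 1) \<gamma>'))"

text \<open>
  \<open>eps_arrow\<close> is the arrow \<open>(\<partial>bar\<^sub>0 \<circ> \<epsilon>\<^sub>1 \<circ> \<partial>\<^sub>2 \<circ> \<dots> \<circ> \<partial>\<^sub>p) w\<close> for \<open>p \<ge> 2\<close>, the single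
  component (index \<open>0\<close>) of an element of \<open>Wbar\<^sub>1 (Dec G)\<close>.
\<close>
definition eps1 :: "'x simplicial_Lie_group \<Rightarrow> (nat \<Rightarrow> 'x) \<Rightarrow> (nat \<Rightarrow> 'x)" where
  "eps1 G w = (\<lambda>j\<in>{..1}.
     if j = 1 then degen G 1 0 (w 1)
     else inv\<^bsub>level G 1\<^esub> (w 1) \<otimes>\<^bsub>level G 1\<^esub> degen G 0 0 (face G 1 0 (w 1))
            \<otimes>\<^bsub>level G 1\<^esub> degen G 0 0 (w 0))"

definition eps_arrow :: "'x simplicial_Lie_group \<Rightarrow> nat \<Rightarrow> (nat \<Rightarrow> 'x) \<Rightarrow> 'x" where
  "eps_arrow G p w = face (Wbar (Dec G)) 2 0 (eps1 G (faces_to_1 G (p - 1) w)) 0"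

text \<open>
  In the recursive equation the degree is \<open>p = q + 2\<close>: component \<open>p\<close> is \<open>s\<^sub>0 \<circ> pr\<^sub>p\<close>, component
  \<open>p - 1\<close> is the pair, and the components below are those of \<open>\<partial>bar\<^sub>0 \<circ> \<epsilon>\<^bsub>p-1\<^esub> \<circ> \<partial>\<^sub>0\<close>.
\<close>
fun eps :: "'x simplicial_Lie_group \<Rightarrow> (nat \<Rightarrow> 'x \<Rightarrow> nat \<Rightarrow> 'x) \<Rightarrow> nat \<Rightarrow> (nat \<Rightarrow> 'x) \<Rightarrow> (nat \<Rightarrow> 'x)"
  where
  "eps G tup 0 w = (\<lambda>j\<in>{..0}. degen G 0 0 (w 0))"
| "eps G tup (Suc 0) w = eps1 G w"
| "eps G tup (Suc (Suc q)) w =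
     (\<lambda>j\<in>{..q + 2}.
        if j = q + 2 then degen G (q + 2) 0 (w (q + 2))
        else if j = q + 1 then cons_simplex G tup (q + 2) (eps_arrow G (q + 2) w) (w (q + 1))
        else face (Wbar (Dec G)) (q + 2) 0 (eps G tup (Suc q) (face (W G) (q + 2) 0 w)) j)"

end

theory Submission
  imports Defs
begin

text \<open>
  Given \<open>w = (w\<^sub>p; \<dots>; w\<^sub>0)\<close> in \<open>W\<^sub>p G\<close>, put \<open>y\<^bsub>p+1\<^esub> = 1\<close> and \<open>y\<^sub>j = d\<^sub>0(y\<^bsub>j+1\<^esub>) \<cdot> w\<^sub>j\<close>. Then
  \<open>\<epsilon>\<^sub>p(w)\<^sub>j = y\<^bsub>j+1\<^esub>\<^sup>-\<^sup>1 \<cdot> s\<^sub>0(y\<^sub>j)\<close> for all \<open>j\<close>: in a nerve a simplex is determined by its image under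
  \<open>d\<^sub>0\<close> and its first arrow, and both agree with those of the pair in the recursive formula. In this
  form \<open>d\<^sub>0(\<epsilon>\<^sub>p(w)\<^sub>j) = w\<^sub>j\<close> is immediate. The sequence \<open>y\<close> turns the faces and degeneracies of \<open>W G\<close>
  into mere shifted faces and degeneracies of \<open>G\<close>, so compatibility with them reduces to the
  simplicial identities. Smoothness follows from that of the group operations; no smoothness of the
  pairing \<open>G\<^sub>1 \<times> G\<^bsub>p-1\<^esub> \<rightarrow> G\<^sub>p\<close> is needed.
\<close>

text \<open>Unrolled, y_j is the product d_0^(p-j)(w_p) ... d_0(w_(j+1)) w_j, and w returns as w_j =
  d_0(y_(j+1))^(-1) y_j. The splitting lifts the two factors along d_0 separately: y_(j+1) lies over
  d_0(y_(j+1)), and s_0(y_j) lies over y_j. In the coordinates y, face i of degree p + 1 omits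
  y_(p+1-i) and degeneracy i of degree p repeats y_(p-i); the entries above that place are hit by
  faces or degeneracies of G. Omission is compatible with the lift because the zeroth face of Dec G
  is d_1 and d_1 s_0 = id, so the entry cancels between neighbouring factors. The recursion hides
  this pattern: it passes to the zeroth face, which forgets y_p = w_p, and so has to supply position
  p - 1 by a separate formula. The amount of analysis comes from defining \<open>Ck\<close> by
  iterated partial derivatives: smoothness of the closed form needs composition of maps, hence a
  chain rule in that setting, and charts on products.\<close>

section \<open>Calculus on open subsets of Euclidean spaces\<close>

text \<open>Coordinates from \<open>m\<close> on vanish at every point of the space, so only the
  first \<open>m\<close> constraints of a basic open set of the product are effective, and the least
  of their radii gives a cube.\<close>

lemma openin_Euclidean_space_box:
  assumes "openin (Euclidean_space m) U" "x \<in> U"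
  shows "\<exists>e>0. \<forall>y\<in>topspace (Euclidean_space m). (\<forall>j<m. \<bar>y j - x j\<bar> < e) \<longrightarrow> y \<in> U"
proof -
  obtain T where T: "openin (powertop_real UNIV) T" and U: "U = T \<inter> {x. \<forall>i\<ge>m. x i = 0}"
    using assms(1) unfolding Euclidean_space_def openin_subtopology by (elim exE conjE)
  have "x \<in> T" using U assms(2) by simp
  have "\<forall>x\<in>T. \<exists>V. finite {i \<in> UNIV. V i \<noteq> topspace euclideanreal} \<and>
      (\<forall>i\<in>UNIV. openin euclideanreal (V i)) \<and> x \<in> Pi\<^sub>E UNIV V \<and> Pi\<^sub>E UNIV V \<subseteq> T"
    using T by (simp only: openin_product_topology_alt)
  from bspec[OF this \<open>x \<in> T\<close>]
  obtain V where V: "\<forall>i\<in>UNIV. openin euclideanreal (V i)" "x \<in> Pi\<^sub>E UNIV V" "Pi\<^sub>E UNIV V \<subseteq> T"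
    by (elim exE conjE)
  have "\<exists>r>0. ball (x j) r \<subseteq> V j" for j
    using bspec[OF V(1) UNIV_I, of j] PiE_mem[OF V(2) UNIV_I, of j]
    unfolding open_openin[symmetric] open_contains_ball by (rule bspec)
  then obtain r where r: "\<And>j. r j > 0" "\<And>j. ball (x j) (r j) \<subseteq> V j" by metis
  \<comment> \<open>The 1 keeps the minimum defined when \<open>m = 0\<close>.\<close>
  define e where "e = Min (insert 1 (r ` {..<m}))"
  have e: "e > 0" "\<And>j. j < m \<Longrightarrow> e \<le> r j"
    using r(1) by (auto simp: e_def)
  have "y \<in> U" if y: "y \<in> topspace (Euclidean_space m)" "\<forall>j<m. \<bar>y j - x j\<bar> < e" for y
  proof -
    have "y j \<in> V j" for j
    proof (cases "j < m")
      case True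
      then have "dist (x j) (y j) < r j"
        using spec[OF y(2), of j] e(2)[OF True] by (simp add: dist_real_def abs_minus_commute)
      then show ?thesis using subsetD[OF r(2)[of j], of "y j"] by simp
    next
      case False
      then have "y j = x j" using y(1) U assms(2) by (simp add: topspace_Euclidean_space)
      then show ?thesis using PiE_mem[OF V(2) UNIV_I, of j] by simp
    qed
    then have "y \<in> Pi\<^sub>E UNIV V" by (simp add: PiE_UNIV_domain)
    with V(3) have "y \<in> T" by (rule subsetD)
    with y(1) show ?thesis by (simp add: U topspace_Euclidean_space)
  qed
  with e show ?thesis by (intro exI[of _ e]) simp
qed

lemma continuous_map_Euclidean_space_box:
  assumes "continuous_map (subtopology (Euclidean_space m) U) euclideanreal f"
    and "openin (Euclidean_space m) U" "x \<in> U" "0 < e"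
  shows "\<exists>d>0. \<forall>y\<in>topspace (Euclidean_space m).
           (\<forall>j<m. \<bar>y j - x j\<bar> < d) \<longrightarrow> y \<in> U \<and> \<bar>f y - f x\<bar> < e"
proof -
  let ?V = "{y \<in> U. f y \<in> ball (f x) e}"
  have "openin (subtopology (Euclidean_space m) U)
      {y \<in> topspace (subtopology (Euclidean_space m) U). f y \<in> ball (f x) e}"
    using assms(1) by (intro openin_continuous_map_preimage) auto
  moreover have "{y \<in> topspace (subtopology (Euclidean_space m) U). f y \<in> ball (f x) e} = ?V"
    using openin_subset[OF assms(2)] by auto
  ultimately have "openin (Euclidean_space m) ?V"
    using assms(2) by (simp add: openin_open_subtopology)
  from openin_Euclidean_space_box[OF this, of x] assms(3,4) show ?thesis
    by (auto simp: dist_real_def abs_minus_commute)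
qed

lemma Euclidean_space_upd:
  "x \<in> topspace (Euclidean_space m) \<Longrightarrow> i < m \<Longrightarrow> x(i := t) \<in> topspace (Euclidean_space m)"
  by (auto simp: topspace_Euclidean_space)

lemma eventually_upd_mem:
  assumes "openin (Euclidean_space m) U" "x \<in> U" "i < m"
  shows "\<forall>\<^sub>F t in nhds (x i). x(i := t) \<in> U"
proof -
  obtain e where e: "e > 0"
    "\<And>y. y\<in>topspace (Euclidean_space m) \<Longrightarrow> (\<forall>j<m. \<bar>y j - x j\<bar> < e) \<Longrightarrow> y \<in> U"
    using openin_Euclidean_space_box[OF assms(1,2)] by blast
  have "x(i := t) \<in> U" if "dist t (x i) < e" for t
    using that e assms openin_subset[OF assms(1)] Euclidean_space_upd[of x m i t]
    by (intro e(2)) (auto simp: dist_real_def)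
  then show ?thesis using e(1) by (auto simp: eventually_nhds_metric)
qed

lemma has_real_derivative_upd_cong:
  assumes "openin (Euclidean_space m) U" "x \<in> U" "i < m" "\<And>y. y \<in> U \<Longrightarrow> f y = g y"
  shows "((\<lambda>t. f (x(i := t))) has_real_derivative D) (at (x i)) \<longleftrightarrow>
         ((\<lambda>t. g (x(i := t))) has_real_derivative D) (at (x i))"
  using eventually_mono[OF eventually_upd_mem[OF assms(1-3)]] assms(4)
  by (intro DERIV_cong_ev) auto

section \<open>Functions of class C^k: restriction, locality, sums and products\<close>

lemma Ck_continuous:
  "Ck k m U f \<Longrightarrow> continuous_map (subtopology (Euclidean_space m) U) euclideanreal f"
  by (cases k) auto

text \<open>The difference quotients in \<open>Ck\<close> may evaluate the function off
  \<open>U\<close>; since \<open>U\<close> is open, the derivatives depend only on values in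
  \<open>U\<close>. The partial derivatives of \<open>f\<close> then serve \<open>g\<close>
  unchanged, so a case distinction replaces induction.\<close>

lemma Ck_cong:
  assumes "openin (Euclidean_space m) U" "\<And>y. y \<in> U \<Longrightarrow> f y = g y" "Ck k m U f"
  shows "Ck k m U g"
proof -
  have "continuous_map (subtopology (Euclidean_space m) U) euclideanreal g"
    by (rule continuous_map_eq[OF Ck_continuous[OF assms(3)]]) (use assms(2) in auto)
  moreover have "((\<lambda>t. f (x(i := t))) has_real_derivative D) (at (x i)) \<longleftrightarrow>
      ((\<lambda>t. g (x(i := t))) has_real_derivative D) (at (x i))" if "x \<in> U" "i < m" for x i D
    by (rule has_real_derivative_upd_cong[OF assms(1) that assms(2)])
  ultimately show ?thesis
    using assms(3) by (cases k) (simp_all del: fun_upd_apply)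
qed

lemma Ck_SucD:
  assumes "Ck (Suc k) m U f"
  shows "\<exists>g. \<forall>i<m. (\<forall>x\<in>U. ((\<lambda>t. f (x(i := t))) has_real_derivative g i x) (at (x i))) \<and>
    Ck k m U (g i)"
proof -
  have "\<forall>i. \<exists>g. i < m \<longrightarrow>
      (\<forall>x\<in>U. ((\<lambda>t. f (x(i := t))) has_real_derivative g x) (at (x i))) \<and> Ck k m U g"
    using assms unfolding Ck.simps by blast
  from choice[OF this] show ?thesis .
qed

lemma Ck_SucI:
  assumes "continuous_map (subtopology (Euclidean_space m) U) euclideanreal f"
    and "\<And>i x. i < m \<Longrightarrow> x \<in> U \<Longrightarrow> ((\<lambda>t. f (x(i := t))) has_real_derivative g i x) (at (x i))"
    and "\<And>i. i < m \<Longrightarrow> Ck k m U (g i)"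
  shows "Ck (Suc k) m U f"
  unfolding Ck.simps
proof (intro conjI allI impI)
  fix i assume i: "i < m"
  show "\<exists>g. (\<forall>x\<in>U. ((\<lambda>t. f (x(i := t))) has_real_derivative g x) (at (x i))) \<and> Ck k m U g"
    by (rule exI[of _ "g i"]) (use assms(2,3)[OF i] in blast)
qed (rule assms(1))

lemma Ck_subset: "Ck k m U f \<Longrightarrow> T \<subseteq> U \<Longrightarrow> Ck k m T f"
proof (induction k arbitrary: f)
  case 0
  then show ?case by (auto intro: continuous_map_from_subtopology_mono)
next
  case (Suc k)
  obtain g where g0: "\<forall>i<m. (\<forall>x\<in>U. ((\<lambda>t. f (x(i := t))) has_real_derivative g i x) (at (x i))) \<and> Ck k m U (g i)"
    using Ck_SucD[OF Suc.prems(1)] ..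
  have g: "\<And>i x. i < m \<Longrightarrow> x \<in> U \<Longrightarrow> ((\<lambda>t. f (x(i := t))) has_real_derivative g i x) (at (x i))"
      "\<And>i. i < m \<Longrightarrow> Ck k m U (g i)"
    using g0 by simp_all
  show ?case
  proof (rule Ck_SucI)
    show "continuous_map (subtopology (Euclidean_space m) T) euclideanreal f"
      using Ck_continuous[OF Suc.prems(1)] Suc.prems(2) by (rule continuous_map_from_subtopology_mono)
    show "((\<lambda>t. f (x(i := t))) has_real_derivative g i x) (at (x i))" if "i < m" "x \<in> T" for i x
      using g(1)[OF that(1)] Suc.prems(2) that(2) by blast
    show "Ck k m T (g i)" if "i < m" for i
      by (rule Suc.IH[OF g(2)[OF that] Suc.prems(2)])
  qed
qed

lemma Ck_Suc_lower: "Ck (Suc k) m U f \<Longrightarrow> Ck k m U f"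
proof (induction k arbitrary: f)
  case (Suc k)
  obtain g where g0: "\<forall>i<m. (\<forall>x\<in>U. ((\<lambda>t. f (x(i := t))) has_real_derivative g i x) (at (x i))) \<and> Ck (Suc k) m U (g i)"
    using Ck_SucD[OF Suc.prems(1)] ..
  have g: "\<And>i x. i < m \<Longrightarrow> x \<in> U \<Longrightarrow> ((\<lambda>t. f (x(i := t))) has_real_derivative g i x) (at (x i))"
      "\<And>i. i < m \<Longrightarrow> Ck (Suc k) m U (g i)"
    using g0 by simp_all
  show ?case
    by (rule Ck_SucI[OF Ck_continuous[OF Suc.prems] g(1) Suc.IH[OF g(2)]])
qed simp

text \<open>The existential witnesses in \<open>Ck\<close> depend on \<open>U\<close>. Naming them
  by \<open>deriv\<close> gives one function for all open sets, which is what lets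
  \<open>Ck_local\<close> glue local statements.\<close>

lemma Ck_Suc_deriv:
  assumes "openin (Euclidean_space m) U" "Ck (Suc k) m U f" "i < m"
  shows "x \<in> U \<Longrightarrow>
      ((\<lambda>t. f (x(i := t))) has_real_derivative deriv (\<lambda>t. f (x(i := t))) (x i)) (at (x i))"
    and "Ck k m U (\<lambda>x. deriv (\<lambda>t. f (x(i := t))) (x i))"
proof -
  obtain g' where g'0: "\<forall>i<m. (\<forall>x\<in>U. ((\<lambda>t. f (x(i := t))) has_real_derivative g' i x) (at (x i))) \<and> Ck k m U (g' i)"
    using Ck_SucD[OF assms(2)] ..
  have g': "\<And>i x. i < m \<Longrightarrow> x \<in> U \<Longrightarrow> ((\<lambda>t. f (x(i := t))) has_real_derivative g' i x) (at (x i))"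
      "\<And>i. i < m \<Longrightarrow> Ck k m U (g' i)"
    using g'0 by simp_all
  define g where "g = g' i"
  have g: "\<And>x. x \<in> U \<Longrightarrow> ((\<lambda>t. f (x(i := t))) has_real_derivative g x) (at (x i))" "Ck k m U g"
    unfolding g_def by (rule g'[OF assms(3)], assumption) (rule g'[OF assms(3)])
  have eq: "g x = deriv (\<lambda>t. f (x(i := t))) (x i)" if "x \<in> U" for x
    by (rule DERIV_imp_deriv[OF g(1)[OF that], symmetric])
  show "((\<lambda>t. f (x(i := t))) has_real_derivative deriv (\<lambda>t. f (x(i := t))) (x i)) (at (x i))"
    if "x \<in> U" using g(1)[OF that] unfolding eq[OF that] .
  show "Ck k m U (\<lambda>x. deriv (\<lambda>t. f (x(i := t))) (x i))"
    by (rule Ck_cong[OF assms(1) eq g(2)])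
qed

lemma continuous_map_local:
  assumes "\<And>x. x \<in> U \<Longrightarrow> \<exists>T. openin X T \<and> x \<in> T \<and> T \<subseteq> U \<and> continuous_map (subtopology X T) Y f"
  shows "continuous_map (subtopology X U) Y f"
proof -
  let ?I = "{T. openin X T \<and> T \<subseteq> U \<and> continuous_map (subtopology X T) Y f}"
  show ?thesis
  proof (rule pasting_lemma[where I="?I" and T="\<lambda>T. T" and f="\<lambda>_. f"])
    fix T assume T: "T \<in> ?I"
    then have "U \<inter> T = T" by blast
    with T show "openin (subtopology X U) T"
      by (simp add: openin_subtopology_Int2[of X T U, unfolded \<open>U \<inter> T = T\<close>])
    from T \<open>U \<inter> T = T\<close> show "continuous_map (subtopology (subtopology X U) T) Y f"
      by (simp add: subtopology_subtopology)
  next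
    fix x assume "x \<in> topspace (subtopology X U)"
    then show "\<exists>T. T \<in> ?I \<and> x \<in> T \<and> f x = f x" using assms[of x] by simp blast
  qed simp
qed

lemma Ck_local:
  assumes "\<And>x. x \<in> U \<Longrightarrow> \<exists>T. openin (Euclidean_space m) T \<and> x \<in> T \<and> T \<subseteq> U \<and> Ck k m T f"
  shows "Ck k m U f"
  using assms
proof (induction k arbitrary: f)
  case 0
  then show ?case by (auto intro!: continuous_map_local)
next
  case (Suc k)
  have U: "openin (Euclidean_space m) U"
    using Suc.prems by (subst openin_subopen) blast
  have loc: "\<exists>T. openin (Euclidean_space m) T \<and> x \<in> T \<and> T \<subseteq> U \<and>
          Ck k m T (\<lambda>x. deriv (\<lambda>t. f (x(i := t))) (x i))" if "i < m" "x \<in> U" for i x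
    using Suc.prems[OF that(2)] Ck_Suc_deriv(2)[OF _ _ that(1)] by meson
  show ?case
  proof (rule Ck_SucI)
    show "continuous_map (subtopology (Euclidean_space m) U) euclideanreal f"
      using Suc.prems Ck_continuous by (intro continuous_map_local) meson
    show "((\<lambda>t. f (x(i := t))) has_real_derivative deriv (\<lambda>t. f (x(i := t))) (x i)) (at (x i))"
      if "i < m" "x \<in> U" for i x
      using Suc.prems[OF that(2)] Ck_Suc_deriv(1)[OF _ _ that(1)] by meson
    show "Ck k m U (\<lambda>x. deriv (\<lambda>t. f (x(i := t))) (x i))" if "i < m" for i
      by (rule Suc.IH) (rule loc[OF that])
  qed
qed

lemma Ck_const: "Ck k m U (\<lambda>_. c)"
  by (induction k arbitrary: c) (auto intro!: exI[of _ "\<lambda>_. 0"])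

lemma Ck_proj:
  assumes "U \<subseteq> topspace (Euclidean_space m)"
  shows "Ck k m U (\<lambda>x. x i)"
proof -
  have "continuous_map (subtopology (Euclidean_space m) U) euclideanreal (\<lambda>x. x i)"
    unfolding Euclidean_space_def
    by (intro continuous_map_from_subtopology continuous_map_product_projection) auto
  then show ?thesis
  proof (cases k)
    case (Suc k')
    have "((\<lambda>t. (x(j := t)) i) has_real_derivative (if j = i then 1 else 0)) (at (x j))" for x :: "nat \<Rightarrow> real" and j
      by (cases "j = i") auto
    with \<open>continuous_map _ _ _\<close> Suc show ?thesis
      by (auto intro!: Ck_SucI Ck_const simp del: fun_upd_apply Ck.simps)
  qed simp
qed

lemma Ck_add: "Ck k m U f \<Longrightarrow> Ck k m U g \<Longrightarrow> Ck k m U (\<lambda>x. f x + g x)"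
proof (induction k arbitrary: f g)
  case 0
  then show ?case by (auto intro!: continuous_map_add)
next
  case (Suc k)
  obtain f' where f'0: "\<forall>i<m. (\<forall>x\<in>U. ((\<lambda>t. f (x(i := t))) has_real_derivative f' i x) (at (x i))) \<and> Ck k m U (f' i)"
    using Ck_SucD[OF Suc.prems(1)] ..
  have f': "\<And>i x. i < m \<Longrightarrow> x \<in> U \<Longrightarrow> ((\<lambda>t. f (x(i := t))) has_real_derivative f' i x) (at (x i))"
      "\<And>i. i < m \<Longrightarrow> Ck k m U (f' i)"
    using f'0 by simp_all
  obtain g' where g'0: "\<forall>i<m. (\<forall>x\<in>U. ((\<lambda>t. g (x(i := t))) has_real_derivative g' i x) (at (x i))) \<and> Ck k m U (g' i)"
    using Ck_SucD[OF Suc.prems(2)] ..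
  have g': "\<And>i x. i < m \<Longrightarrow> x \<in> U \<Longrightarrow> ((\<lambda>t. g (x(i := t))) has_real_derivative g' i x) (at (x i))"
      "\<And>i. i < m \<Longrightarrow> Ck k m U (g' i)"
    using g'0 by simp_all
  show ?case
  proof (rule Ck_SucI)
    show "continuous_map (subtopology (Euclidean_space m) U) euclideanreal (\<lambda>x. f x + g x)"
      using Suc.prems by (intro continuous_map_add Ck_continuous)
    show "((\<lambda>t. f (x(i := t)) + g (x(i := t))) has_real_derivative f' i x + g' i x) (at (x i))"
      if "i < m" "x \<in> U" for i x
      by (rule DERIV_add[OF f'(1)[OF that] g'(1)[OF that]])
    show "Ck k m U (\<lambda>x. f' i x + g' i x)" if "i < m" for i
      by (rule Suc.IH[OF f'(2)[OF that] g'(2)[OF that]])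
  qed
qed

lemma Ck_mult: "Ck k m U f \<Longrightarrow> Ck k m U g \<Longrightarrow> Ck k m U (\<lambda>x. f x * g x)"
proof (induction k arbitrary: f g)
  case 0
  then show ?case by (auto intro!: continuous_map_real_mult)
next
  case (Suc k)
  obtain f' where f'0: "\<forall>i<m. (\<forall>x\<in>U. ((\<lambda>t. f (x(i := t))) has_real_derivative f' i x) (at (x i))) \<and> Ck k m U (f' i)"
    using Ck_SucD[OF Suc.prems(1)] ..
  have f': "\<And>i x. i < m \<Longrightarrow> x \<in> U \<Longrightarrow> ((\<lambda>t. f (x(i := t))) has_real_derivative f' i x) (at (x i))"
      "\<And>i. i < m \<Longrightarrow> Ck k m U (f' i)"
    using f'0 by simp_all
  obtain g' where g'0: "\<forall>i<m. (\<forall>x\<in>U. ((\<lambda>t. g (x(i := t))) has_real_derivative g' i x) (at (x i))) \<and> Ck k m U (g' i)"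
    using Ck_SucD[OF Suc.prems(2)] ..
  have g': "\<And>i x. i < m \<Longrightarrow> x \<in> U \<Longrightarrow> ((\<lambda>t. g (x(i := t))) has_real_derivative g' i x) (at (x i))"
      "\<And>i. i < m \<Longrightarrow> Ck k m U (g' i)"
    using g'0 by simp_all
  show ?case
  proof (rule Ck_SucI)
    show "continuous_map (subtopology (Euclidean_space m) U) euclideanreal (\<lambda>x. f x * g x)"
      using Suc.prems by (intro continuous_map_real_mult Ck_continuous)
    show "((\<lambda>t. f (x(i := t)) * g (x(i := t))) has_real_derivative f' i x * g x + g' i x * f x) (at (x i))"
      if "i < m" "x \<in> U" for i x
      using DERIV_mult[OF f'(1)[OF that] g'(1)[OF that]] unfolding fun_upd_triv .
    show "Ck k m U (\<lambda>x. f' i x * g x + g' i x * f x)" if "i < m" for i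
      by (rule Ck_add[OF Suc.IH[OF f'(2)[OF that] Ck_Suc_lower[OF Suc.prems(2)]]
            Suc.IH[OF g'(2)[OF that] Ck_Suc_lower[OF Suc.prems(1)]]])
  qed
qed

lemma Ck_sum: "finite I \<Longrightarrow> (\<And>i. i \<in> I \<Longrightarrow> Ck k m U (f i)) \<Longrightarrow> Ck k m U (\<lambda>x. \<Sum>i\<in>I. f i x)"
  by (induction I rule: finite_induct) (auto intro: Ck_const Ck_add)

text \<open>
  Changing one coordinate at a time, the mean value theorem expresses each step through a single
  partial derivative at an intermediate point.
\<close>
lemma has_real_derivative_curve:
  fixes c :: "real \<Rightarrow> nat \<Rightarrow> real"
  assumes U: "openin (Euclidean_space m) U" "c t0 \<in> U"
    and c: "\<And>t. c t \<in> topspace (Euclidean_space m)"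
    and c': "\<And>j. j < m \<Longrightarrow> ((\<lambda>t. c t j) has_real_derivative c' j) (at t0)"
    and g: "\<And>j x. j < m \<Longrightarrow> x \<in> U \<Longrightarrow> ((\<lambda>t. f (x(j := t))) has_real_derivative g j x) (at (x j))"
    and cont: "\<And>j. j < m \<Longrightarrow> continuous_map (subtopology (Euclidean_space m) U) euclideanreal (g j)"
  shows "((\<lambda>t. f (c t)) has_real_derivative (\<Sum>j<m. g j (c t0) * c' j)) (at t0)"
proof -
  define h where "h = (\<lambda>l t i. if i < l then c t i else c t0 i)"
  have h_top: "h l t \<in> topspace (Euclidean_space m)" for l t
    using c[of t] c[of t0] by (auto simp: h_def topspace_Euclidean_space)
  have h_step: "h (Suc l) t = (h l t)(l := c t l)" "h l t l = c t0 l" for l t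
    by (auto simp: h_def fun_eq_iff)
  have fc: "f (c t) = f (c t0) + (\<Sum>l<m. f (h (Suc l) t) - f (h l t))" for t
  proof -
    \<comment> \<open>\<open>h l t\<close> takes its first \<open>l\<close> coordinates from
      \<open>c t\<close> and the others from \<open>c t0\<close>. Beyond \<open>m\<close> both
      points are zero, so the telescope is complete after \<open>m\<close> steps.\<close>
    have "h m t = c t" using c[of t] c[of t0] by (auto simp: h_def topspace_Euclidean_space fun_eq_iff)
    moreover have "h 0 t = c t0" by (auto simp: h_def)
    then show ?thesis
      using sum_lessThan_telescope[of "\<lambda>l. f (h l t)" m] \<open>h m t = c t\<close> by simp
  qed
  have close: "\<forall>\<^sub>F t in at t0. \<forall>j<m. \<bar>c t j - c t0 j\<bar> < d" if "0 < d" for d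
  proof -
    have "\<forall>\<^sub>F t in at t0. \<bar>c t j - c t0 j\<bar> < d" if "j < m" for j
      using DERIV_isCont[OF c'[OF that]] \<open>0 < d\<close>
      by (auto simp: isCont_def tendsto_iff dist_real_def)
    then have "\<forall>\<^sub>F t in at t0. \<forall>j\<in>{..<m}. \<bar>c t j - c t0 j\<bar> < d"
      by (intro eventually_ball_finite) auto
    then show ?thesis by (rule eventually_mono) simp
  qed
  \<comment> \<open>Each coordinate of the intermediate point is one of \<open>c t\<close>, one of
    \<open>c t0\<close>, or the value \<open>s\<close>, which is no farther from
    \<open>c t0 l\<close> than \<open>c t l\<close> is.\<close>
  have box: "\<bar>((h l t)(l := s)) j - c t0 j\<bar> < d"
    if "\<forall>j<m. \<bar>c t j - c t0 j\<bar> < d" "\<bar>s - c t0 l\<bar> \<le> \<bar>c t l - c t0 l\<bar>" "l < m" "j < m" for t d s j l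
    using that by (fastforce simp: h_def)
  have step: "((\<lambda>t. f (h (Suc l) t) - f (h l t)) has_real_derivative g l (c t0) * c' l) (at t0)"
    if l: "l < m" for l
  proof -
    obtain e0 where e0: "e0 > 0"
      "\<And>y. y\<in>topspace (Euclidean_space m) \<Longrightarrow> (\<forall>j<m. \<bar>y j - c t0 j\<bar> < e0) \<Longrightarrow> y \<in> U"
      using openin_Euclidean_space_box[OF U] by blast
    have "\<exists>s. \<bar>s - c t0 l\<bar> \<le> \<bar>c t l - c t0 l\<bar> \<and>
        f (h (Suc l) t) - f (h l t) = g l ((h l t)(l := s)) * (c t l - c t0 l)"
      if near: "\<forall>j<m. \<bar>c t j - c t0 j\<bar> < e0" for t
    proof -
      have der: "((\<lambda>r. f ((h l t)(l := r))) has_real_derivative g l ((h l t)(l := s))) (at s)"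
        if "\<bar>s - c t0 l\<bar> \<le> \<bar>c t l - c t0 l\<bar>" for s
      proof -
        have "(h l t)(l := s) \<in> U"
          using box[OF near that l] Euclidean_space_upd[OF h_top l] by (intro e0(2)) blast+
        from g[OF l this] show ?thesis by simp
      qed
      have eq: "f (h (Suc l) t) = f ((h l t)(l := c t l))" "f (h l t) = f ((h l t)(l := c t0 l))"
        using h_step(1)[of l t] fun_upd_triv[of "h l t" l] h_step(2)[of l t] by auto
      \<comment> \<open>\<open>MVT2\<close> wants a strictly ordered interval; in the case of
        equality both sides of the claim are zero.\<close>
      consider "c t0 l < c t l" | "c t l < c t0 l" | "c t l = c t0 l" by linarith
      then show ?thesis
      proof cases
        case 1
        with MVT2[OF 1, of "\<lambda>r. f ((h l t)(l := r))" "\<lambda>s. g l ((h l t)(l := s))"] der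
        obtain z where "z > c t0 l" "z < c t l"
          "f ((h l t)(l := c t l)) - f ((h l t)(l := c t0 l)) = (c t l - c t0 l) * g l ((h l t)(l := z))"
          by (auto simp del: fun_upd_apply)
        then show ?thesis unfolding eq by (intro exI[of _ z]) (auto simp: mult.commute simp del: fun_upd_apply)
      next
        case 2
        with MVT2[OF 2, of "\<lambda>r. f ((h l t)(l := r))" "\<lambda>s. g l ((h l t)(l := s))"] der
        obtain z where "z > c t l" "z < c t0 l"
          "f ((h l t)(l := c t0 l)) - f ((h l t)(l := c t l)) = (c t0 l - c t l) * g l ((h l t)(l := z))"
          by (auto simp del: fun_upd_apply)
        then show ?thesis unfolding eq
          by (intro exI[of _ z]) (auto simp: algebra_simps simp del: fun_upd_apply)
      next
        case 3
        then show ?thesis unfolding eq by (intro exI[of _ "c t l"]) auto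
      qed
    qed
    then have "\<forall>t. \<exists>s. (\<forall>j<m. \<bar>c t j - c t0 j\<bar> < e0) \<longrightarrow> \<bar>s - c t0 l\<bar> \<le> \<bar>c t l - c t0 l\<bar> \<and>
        f (h (Suc l) t) - f (h l t) = g l ((h l t)(l := s)) * (c t l - c t0 l)"
      by blast
    from choice[OF this] obtain s where "\<forall>t. (\<forall>j<m. \<bar>c t j - c t0 j\<bar> < e0) \<longrightarrow>
        \<bar>s t - c t0 l\<bar> \<le> \<bar>c t l - c t0 l\<bar> \<and>
        f (h (Suc l) t) - f (h l t) = g l ((h l t)(l := s t)) * (c t l - c t0 l)" ..
    then have s: "\<bar>s t - c t0 l\<bar> \<le> \<bar>c t l - c t0 l\<bar> \<and>
        f (h (Suc l) t) - f (h l t) = g l ((h l t)(l := s t)) * (c t l - c t0 l)"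
      if "\<forall>j<m. \<bar>c t j - c t0 j\<bar> < e0" for t
      using that by blast
    \<comment> \<open>The choice of \<open>s\<close> follows no rule in \<open>t\<close>, but its
      bound alone drives the evaluation point to \<open>c t0\<close>, where \<open>g l\<close> is
      continuous.\<close>
    have lim: "((\<lambda>t. g l ((h l t)(l := s t))) \<longlongrightarrow> g l (c t0)) (at t0)"
    proof (rule tendstoI)
      fix e :: real assume "e > 0"
      from continuous_map_Euclidean_space_box[OF cont[OF l] U this]
      obtain d where d: "d > 0" "\<And>y. y \<in> topspace (Euclidean_space m) \<Longrightarrow>
        (\<forall>j<m. \<bar>y j - c t0 j\<bar> < d) \<Longrightarrow> \<bar>g l y - g l (c t0)\<bar> < e" by blast
      show "\<forall>\<^sub>F t in at t0. dist (g l ((h l t)(l := s t))) (g l (c t0)) < e"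
        using close[OF d(1)] close[OF e0(1)]
      proof eventually_elim
        case (elim t)
        show ?case unfolding dist_real_def
          using box[OF elim(1) conjunct1[OF s[OF elim(2)]] l] Euclidean_space_upd[OF h_top l]
          by (intro d(2)) blast+
      qed
    qed
    have quot: "((\<lambda>t. (c t l - c t0 l) / (t - t0)) \<longlongrightarrow> c' l) (at t0)"
      using c'[OF l] by (simp add: has_field_derivative_iff)
    have "((\<lambda>t. (f (h (Suc l) t) - f (h l t)) / (t - t0)) \<longlongrightarrow> g l (c t0) * c' l) (at t0)"
    proof (rule Lim_transform_eventually[OF tendsto_mult[OF lim quot]])
      show "\<forall>\<^sub>F t in at t0. g l ((h l t)(l := s t)) * ((c t l - c t0 l) / (t - t0)) =
        (f (h (Suc l) t) - f (h l t)) / (t - t0)"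
        using close[OF e0(1)] by eventually_elim (simp add: s del: fun_upd_apply)
    qed
    moreover have "h l t0 = c t0" for l by (auto simp: h_def)
    ultimately show ?thesis by (simp add: has_field_derivative_iff)
  qed
  have "((\<lambda>t. f (c t0) + (\<Sum>l<m. f (h (Suc l) t) - f (h l t))) has_real_derivative
     0 + (\<Sum>l<m. g l (c t0) * c' l)) (at t0)"
  proof (rule DERIV_add[OF DERIV_const DERIV_sum])
    show "((\<lambda>t. f (h (Suc l) t) - f (h l t)) has_real_derivative g l (c t0) * c' l) (at t0)"
      if "l \<in> {..<m}" for l
      using step[of l] that by simp
  qed
  then show ?thesis by (simp only: fc[symmetric] add_0_left)
qed

text \<open>By the chain rule a partial derivative of the composite is a sum of products of a
  partial derivative of \<open>f\<close>, composed with \<open>F\<close>, and one of a coordinate of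
  \<open>F\<close>. The induction hypothesis is applied to the partial derivatives of
  \<open>f\<close>, so \<open>f\<close> is generalised while \<open>F\<close> stays fixed.\<close>

lemma Ck_compose:
  assumes "openin (Euclidean_space m) U" "openin (Euclidean_space n) V"
    and "\<And>x. x \<in> U \<Longrightarrow> F x \<in> V" "\<And>j. j < n \<Longrightarrow> Ck k m U (\<lambda>x. F x j)" "Ck k n V f"
  shows "Ck k m U (\<lambda>x. f (F x))"
  using assms(4,5)
proof (induction k arbitrary: f)
  case 0
  have "continuous_map (subtopology (Euclidean_space m) U) euclideanreal (\<lambda>x. F x j)" for j
  proof (cases "j < n")
    case False
    \<comment> \<open>Continuity into \<open>Euclidean_space n\<close> is componentwise over all
      naturals; the components from \<open>n\<close> on are zero because \<open>F\<close> maps into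
      \<open>V\<close>.\<close>
    have "F x j = 0" if "x \<in> U" for x
      using subsetD[OF openin_subset[OF assms(2)] assms(3)[OF that]] False
      by (simp add: topspace_Euclidean_space)
    then have "\<And>x. x \<in> topspace (subtopology (Euclidean_space m) U) \<Longrightarrow> 0 = F x j" by simp
    then show ?thesis by (rule continuous_map_eq[OF Ck_continuous[OF Ck_const]])
  next
    case True
    then show ?thesis using 0(1) by simp
  qed
  then have "continuous_map (subtopology (Euclidean_space m) U) (Euclidean_space n) F"
    using subsetD[OF openin_subset[OF assms(2)] assms(3)]
    by (simp add: Euclidean_space_def continuous_map_in_subtopology
        continuous_map_componentwise_UNIV image_subset_iff topspace_subtopology topspace_product_topology)
  then have "continuous_map (subtopology (Euclidean_space m) U) (subtopology (Euclidean_space n) V) F"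
    using assms(3) by (simp add: continuous_map_in_subtopology image_subset_iff)
  from continuous_map_compose[OF this] 0(2) show ?case by (simp add: o_def)
next
  case (Suc k)
  have low: "\<And>j. j < n \<Longrightarrow> Ck k m U (\<lambda>x. F x j)" by (rule Ck_Suc_lower[OF Suc.prems(1)])
  define g where "g = (\<lambda>j x. deriv (\<lambda>t. f (x(j := t))) (x j))"
  define d where "d = (\<lambda>i j x. deriv (\<lambda>t. F (x(i := t)) j) (x i))"
  have g: "((\<lambda>t. f (x(j := t))) has_real_derivative g j x) (at (x j))" if "j < n" "x \<in> V" for j x
    unfolding g_def by (rule Ck_Suc_deriv(1)[OF assms(2) Suc.prems(2) that])
  have g': "Ck k n V (g j)" if "j < n" for j
    unfolding g_def by (rule Ck_Suc_deriv(2)[OF assms(2) Suc.prems(2) that])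
  have d: "((\<lambda>t. F (x(i := t)) j) has_real_derivative d i j x) (at (x i))"
    if "i < m" "j < n" "x \<in> U" for i j x
    unfolding d_def by (rule Ck_Suc_deriv(1)[OF assms(1) Suc.prems(1)[OF that(2)] that(1,3)])
  have d': "Ck k m U (d i j)" if "i < m" "j < n" for i j
    unfolding d_def by (rule Ck_Suc_deriv(2)[OF assms(1) Suc.prems(1)[OF that(2)] that(1)])
  show ?case
  proof (rule Ck_SucI)
    show "continuous_map (subtopology (Euclidean_space m) U) euclideanreal (\<lambda>x. f (F x))"
      by (rule Ck_continuous[OF Suc.IH[OF low Ck_Suc_lower[OF Suc.prems(2)]]])
    show "Ck k m U (\<lambda>x. \<Sum>j<n. g j (F x) * d i j x)" if "i < m" for i
    proof (rule Ck_sum)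
      show "Ck k m U (\<lambda>x. g j (F x) * d i j x)" if "j \<in> {..<n}" for j
        using that \<open>i < m\<close> by (intro Ck_mult Suc.IH[OF low g'] d') simp_all
    qed simp
    show "((\<lambda>t. f (F (x(i := t)))) has_real_derivative (\<Sum>j<n. g j (F x) * d i j x)) (at (x i))"
      if i: "i < m" and x: "x \<in> U" for i x
    proof -
      \<comment> \<open>The curve lemma asks for points of the Euclidean space at every parameter,
        but \<open>F\<close> is controlled only on \<open>U\<close>. Off \<open>U\<close> the curve
        is frozen at \<open>F x\<close>, which changes nothing near \<open>x i\<close>.\<close>
      define c where "c = (\<lambda>t. if x(i := t) \<in> U then F (x(i := t)) else F x)"
      have ev: "\<forall>\<^sub>F t in nhds (x i). c t = F (x(i := t))"
        using eventually_upd_mem[OF assms(1) x i] by (rule eventually_mono) (simp add: c_def)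
      have c0: "c (x i) = F x" by (simp add: c_def)
      have "((\<lambda>t. f (c t)) has_real_derivative (\<Sum>j<n. g j (c (x i)) * d i j x)) (at (x i))"
      proof (rule has_real_derivative_curve[OF assms(2)])
        show "c (x i) \<in> V" unfolding c0 by (rule assms(3)[OF x])
        show "c t \<in> topspace (Euclidean_space n)" for t
          using subsetD[OF openin_subset[OF assms(2)] assms(3)] x by (simp add: c_def)
        show "((\<lambda>t. c t j) has_real_derivative d i j x) (at (x i))" if "j < n" for j
        proof -
          have "\<forall>\<^sub>F t in nhds (x i). c t j = F (x(i := t)) j"
            using ev by (rule eventually_mono) simp
          from DERIV_cong_ev[OF refl this refl] d[OF i that x] show ?thesis by (rule iffD2)
        qed
        show "((\<lambda>t. f (y(j := t))) has_real_derivative g j y) (at (y j))" if "j < n" "y \<in> V" for j y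
          by (rule g[OF that])
        show "continuous_map (subtopology (Euclidean_space n) V) euclideanreal (g j)" if "j < n" for j
          by (rule Ck_continuous[OF g'[OF that]])
      qed
      moreover have "\<forall>\<^sub>F t in nhds (x i). f (c t) = f (F (x(i := t)))"
        using ev by (rule eventually_mono) simp
      ultimately show ?thesis
        unfolding c0 by (subst DERIV_cong_ev[OF refl _ refl, symmetric])
    qed
  qed
qed

section \<open>Smooth maps\<close>

text \<open>Smoothness is tested in every chart of the given atlases, so composing maps takes only a
  covering by charts. For products just this much is established; compatibility of charts is used
  factorwise, in \<open>smooth_map_component\<close>.\<close>

definition charted :: "'a manifold \<Rightarrow> bool" where
  "charted M \<longleftrightarrow> (\<forall>(U, \<phi>) \<in> atlas M. chart M U \<phi>) \<and> (\<Union>(U, \<phi>) \<in> atlas M. U) = points M"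

text \<open>Smoothness of a single real coordinate on a set \<open>S\<close>, typically the preimage
  of a target chart. In this form it can be glued over open covers of \<open>S\<close>.\<close>

definition smooth_fun :: "'a manifold \<Rightarrow> 'a set \<Rightarrow> ('a \<Rightarrow> real) \<Rightarrow> bool" where
  "smooth_fun M S f \<longleftrightarrow>
     (\<forall>(U, \<phi>) \<in> atlas M. \<forall>k. Ck k (mdim M) (\<phi> ` (U \<inter> S)) (\<lambda>y. f (inv_into U \<phi> y)))"

lemma smooth_manifold_charted: "smooth_manifold M \<Longrightarrow> charted M"
  unfolding smooth_manifold_def charted_def smooth_chart_def by blast

lemma charted_chart: "charted M \<Longrightarrow> (U, \<phi>) \<in> atlas M \<Longrightarrow> chart M U \<phi>"
  unfolding charted_def by blast

lemma charted_cover: "charted M \<Longrightarrow> x \<in> points M \<Longrightarrow> \<exists>(U, \<phi>) \<in> atlas M. x \<in> U"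
  unfolding charted_def by blast

lemma chart_subset: "chart M U \<phi> \<Longrightarrow> U \<subseteq> points M"
  unfolding chart_def using openin_subset by blast

lemma chart_topspace:
  assumes "chart M U \<phi>"
  shows "topspace (subtopology (mtop M) U) = U"
    and "topspace (subtopology (Euclidean_space (mdim M)) (\<phi> ` U)) = \<phi> ` U"
  using assms unfolding chart_def by (auto dest!: openin_subset)

lemma chart_inj: "chart M U \<phi> \<Longrightarrow> inj_on \<phi> U"
  using chart_topspace(1) homeomorphic_imp_injective_map unfolding chart_def by metis

lemma chart_image_open:
  assumes "chart M U \<phi>" "openin (mtop M) S"
  shows "openin (Euclidean_space (mdim M)) (\<phi> ` (U \<inter> S))"
proof -
  have "open_map (subtopology (mtop M) U) (subtopology (Euclidean_space (mdim M)) (\<phi> ` U)) \<phi>"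
    using assms(1) homeomorphic_imp_open_map unfolding chart_def by blast
  moreover have "openin (subtopology (mtop M) U) (U \<inter> S)"
    using assms(2) by (simp add: openin_subtopology_Int2)
  ultimately have "openin (subtopology (Euclidean_space (mdim M)) (\<phi> ` U)) (\<phi> ` (U \<inter> S))"
    unfolding open_map_def by blast
  then show ?thesis
    using assms(1) openin_trans_full unfolding chart_def by blast
qed

lemma chart_inv_continuous:
  assumes "chart M U \<phi>"
  shows "continuous_map (subtopology (Euclidean_space (mdim M)) (\<phi> ` U)) (mtop M) (inv_into U \<phi>)"
proof -
  obtain g where g: "homeomorphic_maps (subtopology (mtop M) U)
      (subtopology (Euclidean_space (mdim M)) (\<phi> ` U)) \<phi> g"
    using assms unfolding chart_def homeomorphic_map_maps by blast
  have "g y = inv_into U \<phi> y" if "y \<in> \<phi> ` U" for y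
  proof -
    obtain x where x: "x \<in> U" "y = \<phi> x" using \<open>y \<in> \<phi> ` U\<close> by blast
    have "g (\<phi> x) = x" using g x(1) chart_topspace(1)[OF assms] unfolding homeomorphic_maps_def by blast
    then show ?thesis using x chart_inj[OF assms] by simp
  qed
  moreover have "continuous_map (subtopology (Euclidean_space (mdim M)) (\<phi> ` U)) (mtop M) g"
    using g continuous_map_into_fulltopology unfolding homeomorphic_maps_def by blast
  ultimately show ?thesis
    by (rule continuous_map_eq[rotated]) (simp_all only: chart_topspace(2)[OF assms])
qed

lemma smooth_fun_chart:
  "smooth_fun M S f \<Longrightarrow> (U, \<phi>) \<in> atlas M \<Longrightarrow>
     Ck k (mdim M) (\<phi> ` (U \<inter> S)) (\<lambda>y. f (inv_into U \<phi> y))"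
  unfolding smooth_fun_def by blast

lemma smooth_fun_subset:
  assumes "smooth_fun M S f" "T \<subseteq> S"
  shows "smooth_fun M T f"
  unfolding smooth_fun_def
proof (clarify)
  fix U \<phi> k assume "(U, \<phi>) \<in> atlas M"
  then show "Ck k (mdim M) (\<phi> ` (U \<inter> T)) (\<lambda>y. f (inv_into U \<phi> y))"
    by (rule Ck_subset[OF smooth_fun_chart[OF assms(1)]]) (use assms(2) in blast)
qed

lemma smooth_fun_cong:
  assumes "charted M" "openin (mtop M) S" "\<And>x. x \<in> S \<Longrightarrow> f x = g x" "smooth_fun M S f"
  shows "smooth_fun M S g"
  unfolding smooth_fun_def
proof (clarify)
  fix U \<phi> k assume a: "(U, \<phi>) \<in> atlas M"
  note c = charted_chart[OF assms(1) a]
  show "Ck k (mdim M) (\<phi> ` (U \<inter> S)) (\<lambda>y. g (inv_into U \<phi> y))"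
  proof (rule Ck_cong[OF chart_image_open[OF c assms(2)] _ smooth_fun_chart[OF assms(4) a]])
    fix y assume "y \<in> \<phi> ` (U \<inter> S)"
    then show "f (inv_into U \<phi> y) = g (inv_into U \<phi> y)"
      using chart_inj[OF c] assms(3) by auto
  qed
qed

lemma smooth_fun_local:
  assumes "charted M"
    and "\<And>x. x \<in> S \<Longrightarrow> \<exists>T. openin (mtop M) T \<and> x \<in> T \<and> T \<subseteq> S \<and> smooth_fun M T f"
  shows "smooth_fun M S f"
  unfolding smooth_fun_def
proof (clarify)
  fix U \<phi> k assume a: "(U, \<phi>) \<in> atlas M"
  show "Ck k (mdim M) (\<phi> ` (U \<inter> S)) (\<lambda>y. f (inv_into U \<phi> y))"
  proof (rule Ck_local)
    fix y assume "y \<in> \<phi> ` (U \<inter> S)"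
    then obtain x where x: "x \<in> U" "x \<in> S" "y = \<phi> x" by blast
    obtain T where T: "openin (mtop M) T" "x \<in> T" "T \<subseteq> S" "smooth_fun M T f"
      using assms(2)[OF x(2)] by blast
    show "\<exists>T. openin (Euclidean_space (mdim M)) T \<and> y \<in> T \<and> T \<subseteq> \<phi> ` (U \<inter> S) \<and>
        Ck k (mdim M) T (\<lambda>y. f (inv_into U \<phi> y))"
      using chart_image_open[OF charted_chart[OF assms(1) a] T(1)] x T(2,3)
        smooth_fun_chart[OF T(4) a, of k]
      by (intro exI[of _ "\<phi> ` (U \<inter> T)"]) blast
  qed
qed

lemma smooth_fun_const: "smooth_fun M S (\<lambda>_. c)"
  unfolding smooth_fun_def by (simp add: Ck_const case_prod_beta)

lemma smooth_fun_sum: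
  assumes "finite I" "\<And>i. i \<in> I \<Longrightarrow> smooth_fun M S (f i)"
  shows "smooth_fun M S (\<lambda>x. \<Sum>i\<in>I. f i x)"
  unfolding smooth_fun_def
proof (clarify)
  fix U \<phi> k assume "(U, \<phi>) \<in> atlas M"
  then show "Ck k (mdim M) (\<phi> ` (U \<inter> S)) (\<lambda>y. \<Sum>i\<in>I. f i (inv_into U \<phi> y))"
    by (intro Ck_sum[OF assms(1)] smooth_fun_chart[OF assms(2)])
qed

lemma smooth_fun_chain:
  assumes "charted M" "openin (mtop M) S" "openin (Euclidean_space n) V"
    and "\<And>x. x \<in> S \<Longrightarrow> a x \<in> V" "\<And>j. j < n \<Longrightarrow> smooth_fun M S (\<lambda>x. a x j)" "\<And>k. Ck k n V g"
  shows "smooth_fun M S (\<lambda>x. g (a x))"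
  unfolding smooth_fun_def
proof (clarify)
  fix U \<phi> k assume A: "(U, \<phi>) \<in> atlas M"
  note c = charted_chart[OF assms(1) A]
  show "Ck k (mdim M) (\<phi> ` (U \<inter> S)) (\<lambda>y. g (a (inv_into U \<phi> y)))"
  proof (rule Ck_compose[OF chart_image_open[OF c assms(2)] assms(3) _ _ assms(6)])
    show "a (inv_into U \<phi> y) \<in> V" if "y \<in> \<phi> ` (U \<inter> S)" for y
      using that chart_inj[OF c] assms(4) by auto
    show "Ck k (mdim M) (\<phi> ` (U \<inter> S)) (\<lambda>y. a (inv_into U \<phi> y) j)" if "j < n" for j
      by (rule smooth_fun_chart[OF assms(5)[OF that] A])
  qed
qed

section \<open>Smooth maps and their composition\<close>

lemma smooth_map_iff:
  assumes "charted M"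
  shows "smooth_map M N f \<longleftrightarrow> continuous_map (mtop M) (mtop N) f \<and>
    (\<forall>(V, \<psi>) \<in> atlas N. \<forall>j<mdim N. smooth_fun M {x \<in> points M. f x \<in> V} (\<lambda>x. \<psi> (f x) j))"
proof -
  have "{x \<in> U. f x \<in> V} = U \<inter> {x \<in> points M. f x \<in> V}" if "(U, \<phi>) \<in> atlas M" for U \<phi> V
    using chart_subset[OF charted_chart[OF assms that]] by blast
  then show ?thesis
    unfolding smooth_map_def smooth_fun_def smooth_coords_def by fastforce
qed

lemma smooth_mapI:
  assumes "charted M" "continuous_map (mtop M) (mtop N) f"
    and "\<And>V \<psi> j. (V, \<psi>) \<in> atlas N \<Longrightarrow> j < mdim N \<Longrightarrow>
      smooth_fun M {x \<in> points M. f x \<in> V} (\<lambda>x. \<psi> (f x) j)"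
  shows "smooth_map M N f"
  using assms(2,3) unfolding smooth_map_iff[OF assms(1)] by blast

lemma smooth_map_continuous: "smooth_map M N f \<Longrightarrow> continuous_map (mtop M) (mtop N) f"
  unfolding smooth_map_def by blast

lemma smooth_map_points: "smooth_map M N f \<Longrightarrow> x \<in> points M \<Longrightarrow> f x \<in> points N"
  using smooth_map_continuous continuous_map_image_subset_topspace by blast

lemma smooth_map_preimage_open:
  "smooth_map M N f \<Longrightarrow> openin (mtop N) S \<Longrightarrow> openin (mtop M) {x \<in> points M. f x \<in> S}"
  using smooth_map_continuous openin_continuous_map_preimage by blast

lemma smooth_map_coord:
  assumes "charted M" "smooth_map M N f" "(V, \<psi>) \<in> atlas N" "j < mdim N"
  shows "smooth_fun M {x \<in> points M. f x \<in> V} (\<lambda>x. \<psi> (f x) j)"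
  using assms(2-4) unfolding smooth_map_iff[OF assms(1)] by blast

text \<open>Meant for \<open>eps\<close>, which agrees with its closed form on the points of
  \<open>W\<close> only, not as a total function.\<close>

lemma smooth_map_cong:
  assumes "charted M" "charted N" "\<And>x. x \<in> points M \<Longrightarrow> f x = g x" "smooth_map M N f"
  shows "smooth_map M N g"
proof (rule smooth_mapI[OF assms(1)])
  show "continuous_map (mtop M) (mtop N) g"
    by (rule continuous_map_eq[OF smooth_map_continuous[OF assms(4)] assms(3)])
  fix V \<psi> j assume V: "(V, \<psi>) \<in> atlas N" and j: "j < mdim N"
  have "openin (mtop N) V" using charted_chart[OF assms(2) V] unfolding chart_def by blast
  from smooth_map_preimage_open[OF assms(4) this]
  have "smooth_fun M {x \<in> points M. f x \<in> V} (\<lambda>x. \<psi> (g x) j)"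
    by (rule smooth_fun_cong[OF assms(1) _ _ smooth_map_coord[OF assms(1,4) V j]])
       (simp add: assms(3))
  moreover have "{x \<in> points M. f x \<in> V} = {x \<in> points M. g x \<in> V}" using assms(3) by auto
  ultimately show "smooth_fun M {x \<in> points M. g x \<in> V} (\<lambda>x. \<psi> (g x) j)" by simp
qed

lemma smooth_map_const:
  assumes "charted M" "c \<in> points N"
  shows "smooth_map M N (\<lambda>_. c)"
  unfolding smooth_map_iff[OF assms(1)]
  using assms(2) smooth_fun_const by auto

text \<open>Near a point choose a chart \<psi> of \<open>N\<close> around its image and write the
  composite as (h o \<psi>^(-1)) o (\<psi> o F). The first factor is smooth on the chart image by
  definition of \<open>smooth_fun\<close>, the second because \<open>F\<close> is smooth; such
  neighbourhoods cover the preimage of \<open>S\<close>.\<close>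

lemma smooth_fun_compose:
  assumes "charted M" "charted N" "smooth_map M N F" "openin (mtop N) S" "smooth_fun N S h"
  shows "smooth_fun M {x \<in> points M. F x \<in> S} (\<lambda>x. h (F x))"
proof (rule smooth_fun_local[OF assms(1)])
  fix x assume x: "x \<in> {x \<in> points M. F x \<in> S}"
  then obtain V \<psi> where V: "(V, \<psi>) \<in> atlas N" "F x \<in> V"
    using charted_cover[OF assms(2) smooth_map_points[OF assms(3)]] by blast
  note c = charted_chart[OF assms(2) V(1)]
  define T where "T = {x \<in> points M. F x \<in> V \<inter> S}"
  have "openin (mtop N) (V \<inter> S)" using c assms(4) unfolding chart_def by blast
  then have T: "openin (mtop M) T" unfolding T_def by (rule smooth_map_preimage_open[OF assms(3)])
  have "smooth_fun M T (\<lambda>x. h (inv_into V \<psi> (\<psi> (F x))))"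
  proof (rule smooth_fun_chain[where a="\<lambda>x. \<psi> (F x)" and g="\<lambda>y. h (inv_into V \<psi> y)",
        OF assms(1) T chart_image_open[OF c assms(4)]])
    show "\<psi> (F x) \<in> \<psi> ` (V \<inter> S)" if "x \<in> T" for x using that unfolding T_def by blast
    show "smooth_fun M T (\<lambda>x. \<psi> (F x) j)" if "j < mdim N" for j
      by (rule smooth_fun_subset[OF smooth_map_coord[OF assms(1,3) V(1) that]]) (auto simp: T_def)
    show "Ck k (mdim N) (\<psi> ` (V \<inter> S)) (\<lambda>y. h (inv_into V \<psi> y))" for k
      by (rule smooth_fun_chart[OF assms(5) V(1)])
  qed
  then have "smooth_fun M T (\<lambda>x. h (F x))"
    by (rule smooth_fun_cong[OF assms(1) T, rotated]) (simp add: T_def chart_inj[OF c])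
  then show "\<exists>T. openin (mtop M) T \<and> x \<in> T \<and> T \<subseteq> {x \<in> points M. F x \<in> S} \<and>
      smooth_fun M T (\<lambda>x. h (F x))"
    using T x V(2) by (intro exI[of _ T]) (auto simp: T_def)
qed

lemma smooth_map_compose:
  assumes "charted M" "charted N" "charted P" "smooth_map M N F" "smooth_map N P G"
  shows "smooth_map M P (\<lambda>x. G (F x))"
proof (rule smooth_mapI[OF assms(1)])
  show "continuous_map (mtop M) (mtop P) (\<lambda>x. G (F x))"
    using continuous_map_compose[OF assms(4,5)[THEN smooth_map_continuous]] by (simp add: o_def)
  fix V \<psi> j assume V: "(V, \<psi>) \<in> atlas P" and j: "j < mdim P"
  have "openin (mtop P) V" using charted_chart[OF assms(3) V] unfolding chart_def by blast
  from smooth_map_preimage_open[OF assms(5) this]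
  have "smooth_fun M {x \<in> points M. F x \<in> {y \<in> points N. G y \<in> V}} (\<lambda>x. \<psi> (G (F x)) j)"
    by (rule smooth_fun_compose[OF assms(1,2,4) _ smooth_map_coord[OF assms(2,5) V j]])
  moreover have "{x \<in> points M. F x \<in> {y \<in> points N. G y \<in> V}} = {x \<in> points M. G (F x) \<in> V}"
    using smooth_map_points[OF assms(4)] by auto
  ultimately show "smooth_fun M {x \<in> points M. G (F x) \<in> V} (\<lambda>x. \<psi> (G (F x)) j)" by simp
qed

section \<open>Finite products\<close>

definition block_offset :: "(nat \<Rightarrow> nat) \<Rightarrow> nat set \<Rightarrow> nat \<Rightarrow> nat" where
  "block_offset d I i = (\<Sum>l\<in>{l\<in>I. l < i}. d l)"

text \<open>Padding with zeros puts the value into \<open>Euclidean_space (d i)\<close>, the space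
  in which the chart of factor \<open>i\<close> takes its values.\<close>

definition block :: "(nat \<Rightarrow> nat) \<Rightarrow> nat set \<Rightarrow> nat \<Rightarrow> (nat \<Rightarrow> real) \<Rightarrow> nat \<Rightarrow> real" where
  "block d I i y = (\<lambda>s. if s < d i then y (block_offset d I i + s) else 0)"

text \<open>The formula of the charts in \<open>product_manifold\<close>, detached from the charts
  so that its inversion by \<open>block\<close> is index arithmetic.\<close>

definition concat_blocks :: "(nat \<Rightarrow> nat) \<Rightarrow> nat set \<Rightarrow> (nat \<Rightarrow> nat \<Rightarrow> real) \<Rightarrow> nat \<Rightarrow> real" where
  "concat_blocks d I z r = (\<Sum>i\<in>I.
     if block_offset d I i \<le> r \<and> r < block_offset d I i + d i then z i (r - block_offset d I i) else 0)"

section \<open>Arithmetic of coordinate blocks\<close>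

lemma block_offset_next:
  assumes "finite I" "i \<in> I"
  shows "block_offset d I i + d i = sum d {l \<in> I. l \<le> i}"
proof -
  have "{l \<in> I. l \<le> i} = insert i {l \<in> I. l < i}" using assms(2) by auto
  then show ?thesis using assms(1) by (simp add: block_offset_def)
qed

lemma block_offset_mono:
  assumes "finite I" "i \<in> I" "i < l"
  shows "block_offset d I i + d i \<le> block_offset d I l"
proof -
  have "sum d {l \<in> I. l \<le> i} \<le> block_offset d I l"
    unfolding block_offset_def using assms(1,3) by (intro sum_mono2) auto
  then show ?thesis using block_offset_next[OF assms(1,2), of d] by simp
qed

lemma block_offset_le:
  assumes "finite I" "i \<in> I"
  shows "block_offset d I i + d i \<le> sum d I"
  unfolding block_offset_next[OF assms] using assms(1) by (intro sum_mono2) auto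

text \<open>The right block is the first one that ends beyond \<open>r\<close>. Its offset is 0 or
  the end of its predecessor in \<open>I\<close>, and by minimality the predecessor ends no later
  than \<open>r\<close>.\<close>

lemma block_exists:
  assumes "finite I" "r < sum d I"
  shows "\<exists>i\<in>I. \<exists>s<d i. r = block_offset d I i + s"
proof -
  let ?J = "{i \<in> I. r < block_offset d I i + d i}"
  have I: "I \<noteq> {}" using assms(2) by auto
  have "{l \<in> I. l \<le> Max I} = I" using assms(1) by auto
  then have "Max I \<in> ?J"
    using block_offset_next[OF assms(1) Max_in[OF assms(1) I], of d] assms(2) Max_in[OF assms(1) I]
    by simp
  then have J: "?J \<noteq> {}" "finite ?J" using assms(1) by auto
  define i where "i = Min ?J"
  have i: "i \<in> I" "r < block_offset d I i + d i" using Min_in[OF J(2,1)] unfolding i_def by auto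
  have "block_offset d I i \<le> r"
  proof (cases "{l \<in> I. l < i} = {}")
    case True
    then show ?thesis by (simp only: block_offset_def sum.empty le0)
  next
    case False
    let ?l = "Max {l \<in> I. l < i}"
    have l: "?l \<in> I" "?l < i" using Max_in[OF _ False] assms(1) by auto
    have "\<not> r < block_offset d I ?l + d ?l"
    proof
      assume "r < block_offset d I ?l + d ?l"
      then have "?l \<in> ?J" using l(1) by simp
      then have "i \<le> ?l" unfolding i_def using J(2) by (rule Min_le[rotated])
      with l(2) show False by simp
    qed
    moreover have "{m \<in> I. m \<le> ?l} = {l \<in> I. l < i}"
      using l assms(1) by (auto intro: Max_ge)
    then have "block_offset d I i = block_offset d I ?l + d ?l"
      unfolding block_offset_next[OF assms(1) l(1)] by (simp add: block_offset_def)
    ultimately show ?thesis by simp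
  qed
  with i show ?thesis
    by (intro bexI[of _ i] exI[of _ "r - block_offset d I i"]) auto
qed

text \<open>The blocks are disjoint intervals, so exactly one summand survives.\<close>

lemma concat_blocks_at:
  assumes "finite I" "i \<in> I" "s < d i"
  shows "concat_blocks d I z (block_offset d I i + s) = z i s"
proof -
  let ?r = "block_offset d I i + s"
  have "\<not> (block_offset d I l \<le> ?r \<and> ?r < block_offset d I l + d l)" if "l \<in> I" "l \<noteq> i" for l
    using block_offset_mono[OF assms(1) that(1), of i d] block_offset_mono[OF assms(1,2), of l d]
      that(2) assms(3) by (cases "l < i") auto
  then have "concat_blocks d I z ?r = (\<Sum>l\<in>I. if l = i then z i s else 0)"
    unfolding concat_blocks_def using assms(3) by (intro sum.cong) auto
  then show ?thesis using assms(1,2) by simp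
qed

lemma concat_blocks_beyond:
  assumes "finite I" "sum d I \<le> r"
  shows "concat_blocks d I z r = 0"
  unfolding concat_blocks_def
  using block_offset_le[OF assms(1), of _ d] assms(2) by (intro sum.neutral) fastforce

lemma concat_blocks_Euclidean:
  "finite I \<Longrightarrow> concat_blocks d I z \<in> topspace (Euclidean_space (sum d I))"
  by (simp add: topspace_Euclidean_space concat_blocks_beyond)

lemma block_Euclidean: "block d I i y \<in> topspace (Euclidean_space (d i))"
  by (simp add: topspace_Euclidean_space block_def)

lemma block_concat_blocks:
  assumes "finite I" "i \<in> I" "z i \<in> topspace (Euclidean_space (d i))"
  shows "block d I i (concat_blocks d I z) = z i"
proof
  show "block d I i (concat_blocks d I z) s = z i s" for s
    using assms(3) concat_blocks_at[OF assms(1,2)]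
    by (simp add: block_def topspace_Euclidean_space)
qed

lemma concat_blocks_block:
  assumes "finite I" "y \<in> topspace (Euclidean_space (sum d I))" "\<And>i. i \<in> I \<Longrightarrow> z i = block d I i y"
  shows "concat_blocks d I z = y"
proof
  fix r
  show "concat_blocks d I z r = y r"
  proof (cases "r < sum d I")
    case True
    then obtain i s where i: "i \<in> I" "s < d i" "r = block_offset d I i + s"
      using block_exists[OF assms(1)] by blast
    then show ?thesis
      using concat_blocks_at[OF assms(1) i(1), of s d z] assms(3)[OF i(1)] by (simp add: block_def)
  next
    case False
    then show ?thesis
      using concat_blocks_beyond[OF assms(1), of d r z] assms(2) by (simp add: topspace_Euclidean_space)
  qed
qed

lemma continuous_map_block:
  "continuous_map (Euclidean_space n) (Euclidean_space (d i)) (block d I i)"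
proof -
  have "continuous_map (Euclidean_space n) euclideanreal (\<lambda>y. block d I i y s)" for s
  proof -
    have "continuous_map (Euclidean_space n) euclideanreal (\<lambda>y. y l)" for l
      unfolding Euclidean_space_def
      by (rule continuous_map_from_subtopology[OF continuous_map_product_projection]) simp
    then show ?thesis by (cases "s < d i") (simp_all add: block_def)
  qed
  then have "continuous_map (Euclidean_space n) (powertop_real UNIV) (block d I i)"
    by (simp add: continuous_map_componentwise_UNIV)
  then show ?thesis
    using block_Euclidean[of d I i] unfolding Euclidean_space_def[of "d i"] topspace_Euclidean_space
    by (simp add: continuous_map_in_subtopology image_subset_iff)
qed

abbreviation mdims :: "(nat \<Rightarrow> 'a manifold) \<Rightarrow> nat \<Rightarrow> nat" where
  "mdims M \<equiv> \<lambda>i. mdim (M i)"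

lemma product_manifold_simps:
  "mtop (product_manifold I M) = product_topology (\<lambda>i. mtop (M i)) I"
  "mdim (product_manifold I M) = sum (mdims M) I"
  "points (product_manifold I M) = (\<Pi>\<^sub>E i\<in>I. points (M i))"
  by (simp_all add: product_manifold_def Let_def)

lemma atlas_product_manifold:
  "atlas (product_manifold I M) =
    {(Pi\<^sub>E I U, \<lambda>x. concat_blocks (mdims M) I (\<lambda>i. \<phi> i (x i))) | U \<phi>. \<forall>i\<in>I. (U i, \<phi> i) \<in> atlas (M i)}"
  unfolding product_manifold_def Let_def concat_blocks_def block_offset_def by simp

section \<open>Charts of a finite product\<close>

context
  fixes I :: "nat set" and M :: "nat \<Rightarrow> 'a manifold"
    and U :: "nat \<Rightarrow> 'a set" and \<phi> :: "nat \<Rightarrow> 'a \<Rightarrow> nat \<Rightarrow> real"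
  assumes fin: "finite I" and ch: "\<And>i. i \<in> I \<Longrightarrow> chart (M i) (U i) (\<phi> i)"
begin

abbreviation "prod_chart \<equiv> \<lambda>x. concat_blocks (mdims M) I (\<lambda>i. \<phi> i (x i))"
abbreviation "prod_chart_inv \<equiv> \<lambda>y. \<lambda>i\<in>I. inv_into (U i) (\<phi> i) (block (mdims M) I i y)"

lemma chart_Euclidean: "i \<in> I \<Longrightarrow> x \<in> U i \<Longrightarrow> \<phi> i x \<in> topspace (Euclidean_space (mdim (M i)))"
  using ch openin_subset unfolding chart_def by blast

lemma block_prod_chart:
  assumes "i \<in> I" "x \<in> Pi\<^sub>E I U"
  shows "block (mdims M) I i (prod_chart x) = \<phi> i (x i)"
  by (rule block_concat_blocks[OF fin assms(1)]) (rule chart_Euclidean[OF assms(1) PiE_mem[OF assms(2,1)]])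

lemma prod_chart_inv_left:
  assumes "x \<in> Pi\<^sub>E I U"
  shows "prod_chart_inv (prod_chart x) = x"
proof
  fix i
  show "prod_chart_inv (prod_chart x) i = x i"
  proof (cases "i \<in> I")
    case True
    have "inv_into (U i) (\<phi> i) (\<phi> i (x i)) = x i"
      by (rule inv_into_f_f[OF chart_inj[OF ch[OF True]] PiE_mem[OF assms True]])
    then show ?thesis using True block_prod_chart[OF True assms] by simp
  next
    case False
    then show ?thesis using PiE_arb[OF assms False] by simp
  qed
qed

text \<open>Conditions on the separate blocks exhibit the image as a finite intersection of
  preimages under the continuous maps \<open>block\<close>. Its openness and the continuity of the
  inverse chart are read off from this form.\<close>

lemma prod_chart_image:
  "prod_chart ` Pi\<^sub>E I U =
    {y \<in> topspace (Euclidean_space (sum (mdims M) I)). \<forall>i\<in>I. block (mdims M) I i y \<in> \<phi> i ` U i}"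
proof (intro equalityI subsetI)
  fix y assume "y \<in> prod_chart ` Pi\<^sub>E I U"
  then obtain x where x: "x \<in> Pi\<^sub>E I U" "y = prod_chart x" by blast
  have "block (mdims M) I i y \<in> \<phi> i ` U i" if "i \<in> I" for i
    unfolding x(2) block_prod_chart[OF that x(1)] using PiE_mem[OF x(1) that] by (rule imageI)
  moreover have "y \<in> topspace (Euclidean_space (sum (mdims M) I))"
    unfolding x(2) by (rule concat_blocks_Euclidean[OF fin])
  ultimately show "y \<in> {y \<in> topspace (Euclidean_space (sum (mdims M) I)).
      \<forall>i\<in>I. block (mdims M) I i y \<in> \<phi> i ` U i}" by blast
next
  fix y assume y: "y \<in> {y \<in> topspace (Euclidean_space (sum (mdims M) I)).
      \<forall>i\<in>I. block (mdims M) I i y \<in> \<phi> i ` U i}"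
  have mem: "block (mdims M) I i y \<in> \<phi> i ` U i" if "i \<in> I" for i using y that by blast
  have "prod_chart (prod_chart_inv y) \<in> prod_chart ` Pi\<^sub>E I U"
    by (rule imageI, rule restrict_PiE[THEN iffD2], rule Pi_I) (rule inv_into_into[OF mem])
  moreover have "prod_chart (prod_chart_inv y) = y"
  proof (rule concat_blocks_block[OF fin])
    show "y \<in> topspace (Euclidean_space (sum (mdims M) I))" using y by blast
    show "\<phi> i (prod_chart_inv y i) = block (mdims M) I i y" if "i \<in> I" for i
      unfolding restrict_apply using that f_inv_into_f[OF mem[OF that]] by simp
  qed
  ultimately show "y \<in> prod_chart ` Pi\<^sub>E I U" by (simp only:)
qed

lemma prod_chart_inj: "inj_on prod_chart (Pi\<^sub>E I U)"
  by (rule inj_on_inverseI) (rule prod_chart_inv_left)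

lemma inv_into_prod_chart:
  assumes "y \<in> prod_chart ` Pi\<^sub>E I U"
  shows "inv_into (Pi\<^sub>E I U) prod_chart y = prod_chart_inv y"
proof -
  obtain x where x: "x \<in> Pi\<^sub>E I U" "y = prod_chart x" using assms by blast
  show ?thesis unfolding x(2) prod_chart_inv_left[OF x(1)] by (rule inv_into_f_f[OF prod_chart_inj x(1)])
qed

lemma prod_chart_open: "openin (Euclidean_space (sum (mdims M) I)) (prod_chart ` Pi\<^sub>E I U)"
proof -
  let ?E = "Euclidean_space (sum (mdims M) I)"
  have "openin ?E ((\<Inter>i\<in>I. {y \<in> topspace ?E. block (mdims M) I i y \<in> \<phi> i ` U i}) \<inter> topspace ?E)"
  proof (rule openin_INT[OF fin])
    fix i assume "i \<in> I"
    then have "openin (Euclidean_space (mdim (M i))) (\<phi> i ` U i)"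
      using ch unfolding chart_def by blast
    then show "openin ?E {y \<in> topspace ?E. block (mdims M) I i y \<in> \<phi> i ` U i}"
      by (rule openin_continuous_map_preimage[OF continuous_map_block[where d="mdims M" and i=i]])
  qed
  moreover have "(\<Inter>i\<in>I. {y \<in> topspace ?E. block (mdims M) I i y \<in> \<phi> i ` U i}) \<inter> topspace ?E =
      prod_chart ` Pi\<^sub>E I U"
    unfolding prod_chart_image by blast
  ultimately show ?thesis by simp
qed

lemma prod_chart_continuous:
  "continuous_map (subtopology (product_topology (\<lambda>i. mtop (M i)) I) (Pi\<^sub>E I U))
     (Euclidean_space (sum (mdims M) I)) prod_chart"
proof -
  let ?X = "subtopology (product_topology (\<lambda>i. mtop (M i)) I) (Pi\<^sub>E I U)"
  have coord: "continuous_map ?X euclideanreal (\<lambda>x. \<phi> i (x i) s)" if i: "i \<in> I" for i s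
  proof -
    have 1: "continuous_map ?X (subtopology (mtop (M i)) (U i)) (\<lambda>x. x i)"
      using continuous_map_from_subtopology[OF continuous_map_product_projection[OF i]] i
      by (auto simp: continuous_map_in_subtopology)
    have "continuous_map (subtopology (mtop (M i)) (U i)) (Euclidean_space (mdim (M i))) (\<phi> i)"
      using ch[OF i] homeomorphic_imp_continuous_map continuous_map_into_fulltopology
      unfolding chart_def by blast
    then have "continuous_map (subtopology (mtop (M i)) (U i)) euclideanreal (\<lambda>x. \<phi> i x s)"
      unfolding Euclidean_space_def
      by (simp add: continuous_map_in_subtopology continuous_map_componentwise_UNIV)
    from continuous_map_compose[OF 1 this] show ?thesis by (simp add: o_def)
  qed
  have "continuous_map ?X euclideanreal (\<lambda>x. prod_chart x r)" for r
    unfolding concat_blocks_def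
  proof (rule continuous_map_sum[OF fin])
    fix i assume "i \<in> I"
    then show "continuous_map ?X euclideanreal (\<lambda>x. if block_offset (mdims M) I i \<le> r \<and>
        r < block_offset (mdims M) I i + mdim (M i) then \<phi> i (x i) (r - block_offset (mdims M) I i) else 0)"
      using coord by (cases "block_offset (mdims M) I i \<le> r \<and>
        r < block_offset (mdims M) I i + mdim (M i)") simp_all
  qed
  then have "continuous_map ?X (powertop_real UNIV) prod_chart"
    by (simp add: continuous_map_componentwise_UNIV)
  then show ?thesis
    using concat_blocks_Euclidean[OF fin, of "mdims M"]
    unfolding Euclidean_space_def[of "sum (mdims M) I"] topspace_Euclidean_space
    by (simp add: continuous_map_in_subtopology image_subset_iff)
qed

lemma prod_chart_inv_continuous:
  "continuous_map (subtopology (Euclidean_space (sum (mdims M) I)) (prod_chart ` Pi\<^sub>E I U))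
     (product_topology (\<lambda>i. mtop (M i)) I) prod_chart_inv"
proof -
  let ?Y = "subtopology (Euclidean_space (sum (mdims M) I)) (prod_chart ` Pi\<^sub>E I U)"
  have "continuous_map ?Y (mtop (M i)) (\<lambda>y. inv_into (U i) (\<phi> i) (block (mdims M) I i y))"
    if i: "i \<in> I" for i
  proof -
    have "continuous_map ?Y (Euclidean_space (mdim (M i))) (block (mdims M) I i)"
      by (rule continuous_map_from_subtopology[OF continuous_map_block[where d="mdims M" and i=i]])
    moreover have "block (mdims M) I i y \<in> \<phi> i ` U i" if "y \<in> prod_chart ` Pi\<^sub>E I U" for y
      using that i unfolding prod_chart_image by blast
    ultimately have "continuous_map ?Y (subtopology (Euclidean_space (mdim (M i))) (\<phi> i ` U i))
        (block (mdims M) I i)"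
      by (simp add: continuous_map_in_subtopology image_subset_iff)
    from continuous_map_compose[OF this chart_inv_continuous[OF ch[OF i]]]
    show ?thesis by (simp add: o_def)
  qed
  then show ?thesis
    unfolding continuous_map_componentwise by (simp add: image_subset_iff)
qed

lemma chart_product: "chart (product_manifold I M) (Pi\<^sub>E I U) prod_chart"
proof -
  have U: "openin (product_topology (\<lambda>i. mtop (M i)) I) (Pi\<^sub>E I U)"
    using ch fin unfolding chart_def by (simp add: openin_PiE_gen)
  have top: "topspace (subtopology (product_topology (\<lambda>i. mtop (M i)) I) (Pi\<^sub>E I U)) = Pi\<^sub>E I U"
      "topspace (subtopology (Euclidean_space (sum (mdims M) I)) (prod_chart ` Pi\<^sub>E I U)) =
        prod_chart ` Pi\<^sub>E I U"
    unfolding topspace_subtopology using openin_subset[OF U] openin_subset[OF prod_chart_open] by blast+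
  have "homeomorphic_maps (subtopology (product_topology (\<lambda>i. mtop (M i)) I) (Pi\<^sub>E I U))
      (subtopology (Euclidean_space (sum (mdims M) I)) (prod_chart ` Pi\<^sub>E I U)) prod_chart prod_chart_inv"
    unfolding homeomorphic_maps_def
  proof (intro conjI ballI continuous_map_into_subtopology)
    show "continuous_map (subtopology (product_topology (\<lambda>i. mtop (M i)) I) (Pi\<^sub>E I U))
      (Euclidean_space (sum (mdims M) I)) prod_chart" by (rule prod_chart_continuous)
    show "continuous_map (subtopology (Euclidean_space (sum (mdims M) I)) (prod_chart ` Pi\<^sub>E I U))
     (product_topology (\<lambda>i. mtop (M i)) I) prod_chart_inv" by (rule prod_chart_inv_continuous)
  qed (use prod_chart_inv_left in \<open>auto simp del: restrict_apply simp: top\<close>)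
  then show ?thesis
    unfolding chart_def product_manifold_simps homeomorphic_map_maps
    using U prod_chart_open by blast
qed

end

section \<open>Projections from a product manifold and maps into it\<close>

lemma atlas_product_manifoldD:
  assumes "(S, \<Phi>) \<in> atlas (product_manifold I M)"
  shows "\<exists>U \<phi>. S = Pi\<^sub>E I U \<and> \<Phi> = (\<lambda>x. concat_blocks (mdims M) I (\<lambda>i. \<phi> i (x i))) \<and>
    (\<forall>i\<in>I. (U i, \<phi> i) \<in> atlas (M i))"
  using assms by (simp only: atlas_product_manifold mem_Collect_eq prod.inject conj_assoc)

lemma charted_product_manifold:
  assumes "finite I" "\<And>i. i \<in> I \<Longrightarrow> charted (M i)"
  shows "charted (product_manifold I M)"
  unfolding charted_def
proof (intro conjI equalityI subsetI)
  have *: "chart (product_manifold I M) S \<Phi>" if S: "(S, \<Phi>) \<in> atlas (product_manifold I M)" for S \<Phi>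
  proof -
    obtain U \<phi> where U: "S = Pi\<^sub>E I U" "\<Phi> = (\<lambda>x. concat_blocks (mdims M) I (\<lambda>i. \<phi> i (x i)))"
      "\<forall>i\<in>I. (U i, \<phi> i) \<in> atlas (M i)"
      using atlas_product_manifoldD[OF S] by (elim exE conjE)
    show ?thesis
      unfolding U(1,2)
      by (rule chart_product[OF assms(1) charted_chart[OF assms(2) bspec[OF U(3)]]])
  qed
  then show "\<forall>(S, \<Phi>) \<in> atlas (product_manifold I M). chart (product_manifold I M) S \<Phi>" by blast
  show "x \<in> points (product_manifold I M)"
    if "x \<in> (\<Union>(S, \<Phi>) \<in> atlas (product_manifold I M). S)" for x
    using that chart_subset[OF *] by blast
  fix x assume "x \<in> points (product_manifold I M)"
  then have x: "x \<in> Pi\<^sub>E I (\<lambda>i. points (M i))" by (simp add: product_manifold_simps)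
  have "\<forall>i\<in>I. \<exists>c. c \<in> atlas (M i) \<and> x i \<in> fst c"
  proof
    fix i assume i: "i \<in> I"
    obtain V \<psi> where "(V, \<psi>) \<in> atlas (M i)" "x i \<in> V"
      using charted_cover[OF assms(2)[OF i] PiE_mem[OF x i]] by blast
    then show "\<exists>c. c \<in> atlas (M i) \<and> x i \<in> fst c" by (intro exI[of _ "(V, \<psi>)"]) simp
  qed
  from bchoice[OF this] obtain c where c: "\<forall>i\<in>I. c i \<in> atlas (M i) \<and> x i \<in> fst (c i)" ..
  then have "x \<in> Pi\<^sub>E I (\<lambda>i. fst (c i))" using x by (auto simp: PiE_iff)
  moreover have "(Pi\<^sub>E I (\<lambda>i. fst (c i)), \<lambda>x. concat_blocks (mdims M) I (\<lambda>i. snd (c i) (x i)))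
      \<in> atlas (product_manifold I M)"
    unfolding atlas_product_manifold mem_Collect_eq
    by (rule exI[of _ "\<lambda>i. fst (c i)"], rule exI[of _ "\<lambda>i. snd (c i)"]) (use c in simp)
  ultimately show "x \<in> (\<Union>(S, \<Phi>) \<in> atlas (product_manifold I M). S)" by blast
qed

text \<open>In charts the projection picks a block and then applies a transition map of factor
  \<open>i\<close>, from the chart used in the product to the chart \<psi> of the target. Smoothness
  of that transition map is why the factors are taken to be \<open>smooth_manifold\<close> and not
  merely \<open>charted\<close>.\<close>

lemma smooth_map_component:
  assumes "finite I" "\<And>i. i \<in> I \<Longrightarrow> smooth_manifold (M i)" "i \<in> I"
  shows "smooth_map (product_manifold I M) (M i) (\<lambda>x. x i)"
proof (rule smooth_mapI)
  show "charted (product_manifold I M)"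
    using assms(1,2) by (intro charted_product_manifold smooth_manifold_charted)
  show "continuous_map (mtop (product_manifold I M)) (mtop (M i)) (\<lambda>x. x i)"
    unfolding product_manifold_simps by (rule continuous_map_product_projection[OF assms(3)])
  fix V \<psi> j assume V: "(V, \<psi>) \<in> atlas (M i)" and j: "j < mdim (M i)"
  let ?S = "{x \<in> points (product_manifold I M). x i \<in> V}"
  show "smooth_fun (product_manifold I M) ?S (\<lambda>x. \<psi> (x i) j)"
    unfolding smooth_fun_def
  proof (clarify)
    fix W \<Phi> k assume W: "(W, \<Phi>) \<in> atlas (product_manifold I M)"
    obtain U \<phi> where U: "W = Pi\<^sub>E I U" "\<Phi> = (\<lambda>x. concat_blocks (mdims M) I (\<lambda>i. \<phi> i (x i)))"
      and U_atlas: "\<forall>i\<in>I. (U i, \<phi> i) \<in> atlas (M i)"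
      using atlas_product_manifoldD[OF W] by (elim exE conjE)
    have ch: "\<And>i. i \<in> I \<Longrightarrow> chart (M i) (U i) (\<phi> i)"
      by (rule charted_chart[OF smooth_manifold_charted[OF assms(2)] bspec[OF U_atlas]])
    have chi: "chart (M i) V \<psi>"
      by (rule charted_chart[OF smooth_manifold_charted[OF assms(2)[OF assms(3)]] V])
    have "smooth_chart (M i) (U i) (\<phi> i)"
      using assms(2)[OF assms(3)] bspec[OF U_atlas assms(3)] unfolding smooth_manifold_def by blast
    then have "smooth_coords (mdim (M i)) (\<phi> i ` (U i \<inter> V)) (mdim (M i))
        (\<lambda>y. \<psi> (inv_into (U i) (\<phi> i) y))"
      using V unfolding smooth_chart_def by blast
    then have trans: "Ck k (mdim (M i)) (\<phi> i ` (U i \<inter> V)) (\<lambda>y. \<psi> (inv_into (U i) (\<phi> i) y) j)"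
      using j unfolding smooth_coords_def by blast
    have V_open: "openin (mtop (M i)) V" using chi unfolding chart_def by blast
    have S_open: "openin (mtop (product_manifold I M)) ?S"
      unfolding product_manifold_simps
      using openin_continuous_map_preimage[OF
          continuous_map_product_projection[OF assms(3), where X="\<lambda>i. mtop (M i)"] V_open]
      by simp
    have open1: "openin (Euclidean_space (mdim (product_manifold I M))) (\<Phi> ` (W \<inter> ?S))"
      unfolding U(1,2) by (rule chart_image_open[OF chart_product[OF assms(1) ch] S_open])
    have eq: "inv_into W \<Phi> y i = inv_into (U i) (\<phi> i) (block (mdims M) I i y)"
      "block (mdims M) I i y \<in> \<phi> i ` (U i \<inter> V)" if y: "y \<in> \<Phi> ` (W \<inter> ?S)" for y
    proof -
      obtain x where x: "x \<in> W" "x i \<in> V" "y = \<Phi> x" using y by blast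
      have "x \<in> Pi\<^sub>E I U" using x(1) unfolding U(1) .
      then have "block (mdims M) I i y = \<phi> i (x i)"
        unfolding x(3) U(2)
        by (intro block_prod_chart[where M=M and U=U and \<phi>=\<phi>] assms(1) ch assms(3))
      moreover have "x i \<in> U i" using x(1) assms(3) unfolding U(1) by (rule PiE_mem)
      ultimately show "block (mdims M) I i y \<in> \<phi> i ` (U i \<inter> V)" using x(2) by blast
      have "y \<in> \<Phi> ` W" using x by blast
      then show "inv_into W \<Phi> y i = inv_into (U i) (\<phi> i) (block (mdims M) I i y)"
        using inv_into_prod_chart[where M=M and U=U and \<phi>=\<phi> and y=y, OF assms(1) ch] assms(3)
        unfolding U(1,2) by simp
    qed
    have "Ck k (mdim (product_manifold I M)) (\<Phi> ` (W \<inter> ?S))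
        (\<lambda>y. \<psi> (inv_into (U i) (\<phi> i) (block (mdims M) I i y)) j)"
    proof (rule Ck_compose[where f="\<lambda>y. \<psi> (inv_into (U i) (\<phi> i) y) j" and F="block (mdims M) I i",
          OF open1 chart_image_open[OF ch[OF assms(3)] V_open] eq(2) _ trans])
      show "Ck k (mdim (product_manifold I M)) (\<Phi> ` (W \<inter> ?S)) (\<lambda>y. block (mdims M) I i y s)" for s
        by (cases "s < mdim (M i)") (simp_all add: block_def Ck_const Ck_proj[OF openin_subset[OF open1]])
    qed
    then show "Ck k (mdim (product_manifold I M)) (\<Phi> ` (W \<inter> ?S)) (\<lambda>y. \<psi> (inv_into W \<Phi> y i) j)"
      by (rule Ck_cong[OF open1, rotated]) (simp only: eq(1))
  qed
qed

text \<open>A coordinate of a product chart is a sum whose terms are either a coordinate of one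
  component or the constant 0.\<close>

lemma smooth_map_into_product:
  assumes "charted M" "finite I" "\<And>i. i \<in> I \<Longrightarrow> smooth_map M (N i) (\<lambda>x. f x i)"
    and "\<And>x. x \<in> points M \<Longrightarrow> f x \<in> extensional I"
  shows "smooth_map M (product_manifold I N) f"
proof (rule smooth_mapI[OF assms(1)])
  show "continuous_map (mtop M) (mtop (product_manifold I N)) f"
    unfolding product_manifold_simps continuous_map_componentwise
    using assms(4) smooth_map_continuous[OF assms(3)] by blast
  fix W \<Psi> r assume W: "(W, \<Psi>) \<in> atlas (product_manifold I N)"
  obtain V \<psi> where V: "W = Pi\<^sub>E I V" "\<Psi> = (\<lambda>x. concat_blocks (mdims N) I (\<lambda>i. \<psi> i (x i)))"
      "\<forall>i\<in>I. (V i, \<psi> i) \<in> atlas (N i)"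
    using atlas_product_manifoldD[OF W] by (elim exE conjE)
  show "smooth_fun M {x \<in> points M. f x \<in> W} (\<lambda>x. \<Psi> (f x) r)"
    unfolding V(2) concat_blocks_def
  proof (rule smooth_fun_sum[OF assms(2)])
    fix i assume i: "i \<in> I"
    let ?o = "block_offset (mdims N) I i"
    have "smooth_fun M {x \<in> points M. f x \<in> W} (\<lambda>x. \<psi> i (f x i) (r - ?o))"
      if "?o \<le> r" "r < ?o + mdim (N i)"
    proof (rule smooth_fun_subset[OF smooth_map_coord[OF assms(1) assms(3)[OF i] bspec[OF V(3) i]]])
      show "r - ?o < mdim (N i)" using that by simp
      show "{x \<in> points M. f x \<in> W} \<subseteq> {x \<in> points M. f x i \<in> V i}"
        unfolding V(1) using PiE_mem[OF _ i] by blast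
    qed
    then show "smooth_fun M {x \<in> points M. f x \<in> W}
        (\<lambda>x. if ?o \<le> r \<and> r < ?o + mdim (N i) then \<psi> i (f x i) (r - ?o) else 0)"
      by (cases "?o \<le> r \<and> r < ?o + mdim (N i)")
         (simp_all only: if_True if_False smooth_fun_const simp_thms)
  qed
qed

section \<open>Smoothness of pointwise group operations\<close>

lemma Lie_group_charted: "Lie_group L \<Longrightarrow> charted (mfd L)"
  unfolding Lie_group_def using smooth_manifold_charted by blast

lemma smooth_map_mult:
  assumes "Lie_group L" "charted M" "smooth_map M (mfd L) f" "smooth_map M (mfd L) g"
  shows "smooth_map M (mfd L) (\<lambda>x. f x \<otimes>\<^bsub>L\<^esub> g x)"
proof -
  let ?P = "product_manifold {0, 1} (\<lambda>_::nat. mfd L)"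
  let ?h = "\<lambda>x. \<lambda>i\<in>{0, 1::nat}. if i = 0 then f x else g x"
  have P: "charted ?P" using Lie_group_charted[OF assms(1)] by (intro charted_product_manifold) auto
  have mult: "smooth_map ?P (mfd L) (\<lambda>z. z 0 \<otimes>\<^bsub>L\<^esub> z 1)" using assms(1) unfolding Lie_group_def by blast
  have "smooth_map M ?P ?h"
    by (rule smooth_map_into_product[OF assms(2)]) (use assms(3,4) in auto)
  from smooth_map_compose[OF assms(2) P Lie_group_charted[OF assms(1)] this mult] show ?thesis by simp
qed

lemma smooth_map_inv:
  assumes "Lie_group L" "charted M" "smooth_map M (mfd L) f"
  shows "smooth_map M (mfd L) (\<lambda>x. inv\<^bsub>L\<^esub> f x)"
proof -
  have "smooth_map (mfd L) (mfd L) (\<lambda>x. inv\<^bsub>L\<^esub> x)" using assms(1) unfolding Lie_group_def by blast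
  from smooth_map_compose[OF assms(2) Lie_group_charted[OF assms(1)] Lie_group_charted[OF assms(1)]
      assms(3) this] show ?thesis .
qed

section \<open>The splitting for simplicial Lie groups\<close>

locale simplicial_Lie_group_loc =
  fixes G :: "'x simplicial_Lie_group"
  assumes simplicial_Lie_group: "simplicial_Lie_group G"
begin

abbreviation "L n \<equiv> level G n"
abbreviation "C n \<equiv> carrier (level G n)"

lemma Lie: "Lie_group (L n)"
  using simplicial_Lie_group unfolding simplicial_Lie_group_def by blast

lemma points_level: "points (mfd (L n)) = C n"
  using Lie unfolding Lie_group_def by blast

sublocale group "L n" for n
  using Lie unfolding Lie_group_def by blast

lemma face_hom: "i \<le> Suc n \<Longrightarrow> face G (Suc n) i \<in> hom (L (Suc n)) (L n)"
  and face_smooth: "i \<le> Suc n \<Longrightarrow> smooth_map (mfd (L (Suc n))) (mfd (L n)) (face G (Suc n) i)"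
  and degen_hom: "j \<le> n \<Longrightarrow> degen G n j \<in> hom (L n) (L (Suc n))"
  and degen_smooth: "j \<le> n \<Longrightarrow> smooth_map (mfd (L n)) (mfd (L (Suc n))) (degen G n j)"
  using simplicial_Lie_group unfolding simplicial_Lie_group_def by simp_all

lemma face_group_hom: "i \<le> Suc n \<Longrightarrow> group_hom (L (Suc n)) (L n) (face G (Suc n) i)"
  by (intro group_hom.intro group_hom_axioms.intro face_hom is_group)

lemma degen_group_hom: "j \<le> n \<Longrightarrow> group_hom (L n) (L (Suc n)) (degen G n j)"
  by (intro group_hom.intro group_hom_axioms.intro degen_hom is_group)

lemma face_closed [simp]: "i \<le> Suc n \<Longrightarrow> x \<in> C (Suc n) \<Longrightarrow> face G (Suc n) i x \<in> C n"
  by (rule group_hom.hom_closed[OF face_group_hom])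

lemma face_mult:
  "i \<le> Suc n \<Longrightarrow> x \<in> C (Suc n) \<Longrightarrow> y \<in> C (Suc n) \<Longrightarrow>
    face G (Suc n) i (x \<otimes>\<^bsub>L (Suc n)\<^esub> y) = face G (Suc n) i x \<otimes>\<^bsub>L n\<^esub> face G (Suc n) i y"
  by (rule group_hom.hom_mult[OF face_group_hom])

lemma face_one: "i \<le> Suc n \<Longrightarrow> face G (Suc n) i \<one>\<^bsub>L (Suc n)\<^esub> = \<one>\<^bsub>L n\<^esub>"
  by (rule group_hom.hom_one[OF face_group_hom])

lemma face_inv:
  "i \<le> Suc n \<Longrightarrow> x \<in> C (Suc n) \<Longrightarrow> face G (Suc n) i (inv\<^bsub>L (Suc n)\<^esub> x) = inv\<^bsub>L n\<^esub> face G (Suc n) i x"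
  by (rule group_hom.hom_inv[OF face_group_hom])

lemma degen_closed [simp]: "j \<le> n \<Longrightarrow> x \<in> C n \<Longrightarrow> degen G n j x \<in> C (Suc n)"
  by (rule group_hom.hom_closed[OF degen_group_hom])

lemma degen_mult:
  "j \<le> n \<Longrightarrow> x \<in> C n \<Longrightarrow> y \<in> C n \<Longrightarrow>
    degen G n j (x \<otimes>\<^bsub>L n\<^esub> y) = degen G n j x \<otimes>\<^bsub>L (Suc n)\<^esub> degen G n j y"
  by (rule group_hom.hom_mult[OF degen_group_hom])

lemma degen_one: "j \<le> n \<Longrightarrow> degen G n j \<one>\<^bsub>L n\<^esub> = \<one>\<^bsub>L (Suc n)\<^esub>"
  by (rule group_hom.hom_one[OF degen_group_hom])

lemma degen_inv:
  "j \<le> n \<Longrightarrow> x \<in> C n \<Longrightarrow> degen G n j (inv\<^bsub>L n\<^esub> x) = inv\<^bsub>L (Suc n)\<^esub> degen G n j x"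
  by (rule group_hom.hom_inv[OF degen_group_hom])

lemma identities: "simplicial_identities (\<lambda>n. C n) (face G) (degen G)"
  using simplicial_Lie_group unfolding simplicial_Lie_group_def by blast

section \<open>The simplicial identities that involve \<open>d_0\<close> or
  \<open>s_0\<close>\<close>

lemma face_0_face_Suc:
  assumes "x \<in> C (Suc (Suc n))" "k \<le> Suc n"
  shows "face G (Suc n) 0 (face G (Suc (Suc n)) (Suc k) x) =
    face G (Suc n) k (face G (Suc (Suc n)) 0 x)"
proof -
  have "\<forall>n i j. \<forall>x\<in>C (n + 2). i < j \<and> j \<le> n + 2 \<longrightarrow>
        face G (n + 1) i (face G (n + 2) j x) = face G (n + 1) (j - 1) (face G (n + 2) i x)"
    using identities unfolding simplicial_identities_def by (elim conjE)
  from this[rule_format, of x n 0 "Suc k"] assms show ?thesis by simp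
qed

lemma degen_0_degen:
  assumes "x \<in> C n" "k \<le> n"
  shows "degen G (Suc n) 0 (degen G n k x) = degen G (Suc n) (Suc k) (degen G n 0 x)"
proof -
  have "\<forall>n i j. \<forall>x\<in>C n. i \<le> j \<and> j \<le> n \<longrightarrow>
        degen G (n + 1) i (degen G n j x) = degen G (n + 1) (j + 1) (degen G n i x)"
    using identities unfolding simplicial_identities_def by (elim conjE)
  from this[rule_format, of x n 0 k] assms show ?thesis by simp
qed

lemma face_0_degen_Suc:
  assumes "x \<in> C (Suc n)" "k \<le> n"
  shows "face G (Suc (Suc n)) 0 (degen G (Suc n) (Suc k) x) = degen G n k (face G (Suc n) 0 x)"
proof -
  have "\<forall>n i j. \<forall>x\<in>C n. i < j \<and> j \<le> n \<longrightarrow>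
        face G (n + 1) i (degen G n j x) = degen G (n - 1) (j - 1) (face G n i x)"
    using identities unfolding simplicial_identities_def by (elim conjE)
  from this[rule_format, of x "Suc n" 0 "Suc k"] assms show ?thesis by simp
qed

lemma face_degen_0:
  assumes "x \<in> C n"
  shows "face G (Suc n) 0 (degen G n 0 x) = x" "face G (Suc n) (Suc 0) (degen G n 0 x) = x"
proof -
  have "\<forall>n j. \<forall>x\<in>C n. j \<le> n \<longrightarrow>
      face G (n + 1) j (degen G n j x) = x \<and> face G (n + 1) (j + 1) (degen G n j x) = x"
    using identities unfolding simplicial_identities_def by (elim conjE)
  from this[rule_format, of x n 0] assms
  show "face G (Suc n) 0 (degen G n 0 x) = x" "face G (Suc n) (Suc 0) (degen G n 0 x) = x" by simp_all
qed

lemma face_Suc_Suc_degen_0: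
  assumes "x \<in> C (Suc n)" "k \<le> n"
  shows "face G (Suc (Suc n)) (Suc (Suc k)) (degen G (Suc n) 0 x) = degen G n 0 (face G (Suc n) (Suc k) x)"
proof -
  have "\<forall>n i j. \<forall>x\<in>C n. j + 1 < i \<and> i \<le> n + 1 \<longrightarrow>
        face G (n + 1) i (degen G n j x) = degen G (n - 1) j (face G n (i - 1) x)"
    using identities unfolding simplicial_identities_def by (elim conjE)
  from this[rule_format, of x "Suc n" 0 "Suc (Suc k)"] assms show ?thesis by simp
qed

end

lemma points_W: "points (level (W K) p) = (\<Pi>\<^sub>E j\<in>{..p}. points (mfd (level K j)))"
  by (simp add: W_def Dec_def Wbar_def product_manifold_simps lessThan_Suc_atMost)

text \<open>Comparing \<open>j + i\<close> with \<open>p\<close> avoids truncated subtraction. The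
  shift in \<open>Dec\<close> excludes the zeroth face of \<open>Wbar\<close>, and its last face
  falls under the third case: for \<open>i = Suc p\<close> the sum always exceeds \<open>p\<close>
  and the face index is \<open>Suc j\<close>.\<close>

lemma face_W:
  assumes "j \<le> p" "i \<le> Suc p"
  shows "face (W K) (Suc p) i w j =
    (if j + i < p then w j
     else if j + i = p then face K (Suc j) 0 (w (Suc j)) \<otimes>\<^bsub>level K j\<^esub> w j
     else face K (Suc j) (j + i - p) (w (Suc j)))"
  using assms by (auto simp: W_def Dec_def Wbar_def)

text \<open>In the third case \<open>i \<le> p\<close> forces \<open>j\<close> to be positive, so
  neither subtraction is truncated.\<close>

lemma degen_W:
  assumes "j \<le> Suc p" "i \<le> p"
  shows "degen (W K) p i w j =
    (if j + i < p then w j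
     else if j + i = p then \<one>\<^bsub>level K j\<^esub>
     else degen K (j - 1) (j + i - p - 1) (w (j - 1)))"
  using assms by (auto simp: W_def Dec_def Wbar_def)

lemma face_W_extensional: "face (W K) (Suc p) i w \<in> extensional {..p}"
  by (simp add: W_def Dec_def Wbar_def lessThan_Suc_atMost)

lemma degen_W_extensional: "degen (W K) p i w \<in> extensional {..Suc p}"
  by (simp add: W_def Dec_def Wbar_def lessThan_Suc_atMost)

text \<open>The sequence \<open>y\<close> attached to \<open>w\<close>.\<close>
function left_product :: "'x simplicial_Lie_group \<Rightarrow> nat \<Rightarrow> (nat \<Rightarrow> 'x) \<Rightarrow> nat \<Rightarrow> 'x" where
  "left_product G p w j =
     (if j \<le> p then face G (Suc j) 0 (left_product G p w (Suc j)) \<otimes>\<^bsub>level G j\<^esub> w j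
      else \<one>\<^bsub>level G j\<^esub>)"
  by pat_completeness auto
termination by (relation "Wellfounded.measure (\<lambda>(G, p, w, j). Suc p - j)") auto

declare left_product.simps [simp del]

definition twist :: "'x simplicial_Lie_group \<Rightarrow> nat \<Rightarrow> (nat \<Rightarrow> 'x) \<Rightarrow> nat \<Rightarrow> 'x" where
  "twist G p w j = inv\<^bsub>level G (Suc j)\<^esub> left_product G p w (Suc j) \<otimes>\<^bsub>level G (Suc j)\<^esub>
     degen G j 0 (left_product G p w j)"

lemma left_product_step:
  "j \<le> p \<Longrightarrow> left_product G p w j =
    face G (Suc j) 0 (left_product G p w (Suc j)) \<otimes>\<^bsub>level G j\<^esub> w j"
  by (simp add: left_product.simps[of G p w j])

lemma left_product_beyond: "p < j \<Longrightarrow> left_product G p w j = \<one>\<^bsub>level G j\<^esub>"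
  by (simp add: left_product.simps[of G p w j])

lemma level_W: "level (W K) p = product_manifold {..p} (\<lambda>j. mfd (level K j))"
  by (simp add: W_def Dec_def Wbar_def lessThan_Suc_atMost)

section \<open>The closed form under faces and degeneracies\<close>

context simplicial_Lie_group_loc
begin

lemma charted_W: "charted (level (W G) p)"
  unfolding level_W by (intro charted_product_manifold Lie_group_charted[OF Lie]) simp

lemma left_product_closed [simp]:
  assumes "\<And>j. j \<le> p \<Longrightarrow> w j \<in> C j"
  shows "left_product G p w j \<in> C j"
proof (induction "Suc p - j" arbitrary: j)
  case 0
  then show ?case by (simp add: left_product_beyond)
next
  case (Suc m)
  then have "left_product G p w (Suc j) \<in> C (Suc j)" by simp
  with Suc(2) show ?case by (simp add: left_product_step assms)
qed

lemma left_product_top: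
  assumes "w p \<in> C p"
  shows "left_product G p w p = w p"
  using assms by (simp add: left_product_step left_product_beyond face_one)

lemma twist_closed:
  assumes "\<And>j. j \<le> p \<Longrightarrow> w j \<in> C j"
  shows "twist G p w j \<in> C (Suc j)"
  using left_product_closed[of p w, OF assms] by (simp add: twist_def)

lemma twist_top:
  assumes "w p \<in> C p"
  shows "twist G p w p = degen G p 0 (w p)"
  using assms by (simp add: twist_def left_product_top left_product_beyond)

lemma face_0_twist:
  assumes "\<And>j. j \<le> p \<Longrightarrow> w j \<in> C j" "j \<le> p"
  shows "face G (Suc j) 0 (twist G p w j) = w j"
proof -
  note y = left_product_closed[of p w, OF assms(1)]
  have "face G (Suc j) 0 (twist G p w j) =
      inv\<^bsub>L j\<^esub> face G (Suc j) 0 (left_product G p w (Suc j)) \<otimes>\<^bsub>L j\<^esub> left_product G p w j"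
    unfolding twist_def by (simp add: face_mult face_inv face_degen_0 y)
  also have "\<dots> = w j"
    unfolding left_product_step[OF assms(2)] using assms y by (simp add: m_assoc[symmetric])
  finally show ?thesis .
qed

lemma face_W_closed:
  assumes "\<And>j. j \<le> Suc p \<Longrightarrow> w j \<in> C j" "i \<le> Suc p" "j \<le> p"
  shows "face (W G) (Suc p) i w j \<in> C j"
  using assms by (simp add: face_W)

text \<open>The multiplication in face \<open>i\<close> of \<open>W\<close> fuses two steps of the
  recursion, so y_(p+1-i) disappears from the list, while the later entries move down one place
  under a face of G. The range includes \<open>j = Suc p\<close> because \<open>twist\<close> at
  \<open>p\<close> reads the entry one past the end.\<close>

lemma left_product_face:
  assumes w: "\<And>j. j \<le> Suc p \<Longrightarrow> w j \<in> C j" and i: "i \<le> Suc p"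
  shows "j \<le> Suc p \<Longrightarrow> left_product G p (face (W G) (Suc p) i w) j =
    (if j + i \<le> p then left_product G (Suc p) w j
     else face G (Suc j) (j + i - p) (left_product G (Suc p) w (Suc j)))"
proof (induction "Suc p - j" arbitrary: j)
  case 0
  then have "j = Suc p" by simp
  \<comment> \<open>Past the end both sequences are 1, and faces preserve 1.\<close>
  then show ?case using i by (simp add: left_product_beyond face_one)
next
  case (Suc m)
  note y = left_product_closed[of "Suc p" w, OF w]
  have j: "j \<le> p" using Suc(2) by simp
  have IH: "left_product G p (face (W G) (Suc p) i w) (Suc j) =
    (if Suc j + i \<le> p then left_product G (Suc p) w (Suc j)
     else face G (Suc (Suc j)) (Suc j + i - p) (left_product G (Suc p) w (Suc (Suc j))))"
    using Suc j by simp
  note step = left_product_step[OF j, of G "face (W G) (Suc p) i w"]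
    left_product_step[of j "Suc p" G w] left_product_step[of "Suc j" "Suc p" G w]
  consider "j + i < p" | "j + i = p" | "p < j + i" by linarith
  then show ?case
  proof cases
    case 1
    then show ?thesis using step(1,2) IH j i by (simp add: face_W)
  next
    case 2
    \<comment> \<open>Here the preceding entry has become d_1 y_(j+2), and d_0 d_1 = d_0 d_0
      reassembles d_0(d_0(y_(j+2)) w_(j+1)) w_j, which is y_j.\<close>
    then have "left_product G p (face (W G) (Suc p) i w) j =
      face G (Suc j) 0 (face G (Suc (Suc j)) (Suc 0) (left_product G (Suc p) w (Suc (Suc j)))) \<otimes>\<^bsub>L j\<^esub>
        (face G (Suc j) 0 (w (Suc j)) \<otimes>\<^bsub>L j\<^esub> w j)"
      using step(1) IH j i by (simp add: face_W Suc_diff_le)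
    also have "\<dots> = left_product G (Suc p) w j"
      using j step(2,3) w y by (simp add: face_0_face_Suc m_assoc face_mult)
    finally show ?thesis using 2 by simp
  next
    case 3
    define k where "k = j + i - p"
    have k: "k \<le> Suc j" "Suc j + i - p = Suc k" using 3 i by (auto simp: k_def)
    have "left_product G p (face (W G) (Suc p) i w) j =
      face G (Suc j) 0 (face G (Suc (Suc j)) (Suc k) (left_product G (Suc p) w (Suc (Suc j)))) \<otimes>\<^bsub>L j\<^esub>
        face G (Suc j) k (w (Suc j))"
      using step(1) IH j i 3 k by (simp add: face_W k_def)
    also have "\<dots> = face G (Suc j) k (left_product G (Suc p) w (Suc j))"
      using j step(3) w y k by (simp add: face_0_face_Suc face_mult)
    finally show ?thesis using 3 by (simp add: k_def)
  qed
qed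

text \<open>At \<open>j + i = p\<close> the two factors multiply to (d_1 y_(j+2))^(-1) (d_1 s_0
  y_(j+1)) y_(j+1)^(-1) s_0(y_j). As d_1 s_0 = id, the entry y_(j+1) cancels, and it is exactly the
  one that \<open>left_product_face\<close> omits. Above this place s_0 commutes with the faces up
  to a shift.\<close>

lemma twist_face:
  assumes w: "\<And>j. j \<le> Suc p \<Longrightarrow> w j \<in> C j" and i: "i \<le> Suc p" and j: "j \<le> p"
  shows "twist G p (face (W G) (Suc p) i w) j = face (W (Dec G)) (Suc p) i (twist G (Suc p) w) j"
proof -
  note y = left_product_closed[of "Suc p" w, OF w]
  note lpf = left_product_face[where w=w and p=p, OF w i]
  have Dec: "level (Dec G) n = L (Suc n)" "face (Dec G) n k = face G (Suc n) (Suc k)" for n k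
    by (simp_all add: Dec_def)
  consider "j + i < p" | "j + i = p" | "p < j + i" by linarith
  then show ?thesis
  proof cases
    case 1
    then show ?thesis using i j by (simp add: twist_def lpf face_W)
  next
    case 2
    have "face (W (Dec G)) (Suc p) i (twist G (Suc p) w) j =
      face G (Suc (Suc j)) (Suc 0) (twist G (Suc p) w (Suc j)) \<otimes>\<^bsub>L (Suc j)\<^esub> twist G (Suc p) w j"
      using 2 i j by (simp add: face_W Dec)
    also have "\<dots> = inv\<^bsub>L (Suc j)\<^esub> face G (Suc (Suc j)) (Suc 0) (left_product G (Suc p) w (Suc (Suc j)))
      \<otimes>\<^bsub>L (Suc j)\<^esub> degen G j 0 (left_product G (Suc p) w j)"
      unfolding twist_def using y
      by (simp add: face_mult face_inv face_degen_0 m_assoc) (simp add: m_assoc[symmetric])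
    finally show ?thesis using 2 j by (simp add: twist_def lpf Suc_diff_le)
  next
    case 3
    define k where "k = j + i - p"
    \<comment> \<open>The exchange d_(k+1) s_0 = s_0 d_k requires \<open>k\<close> positive; at
      \<open>k = 0\<close> the left side is the identity instead.\<close>
    obtain k' where k': "k = Suc k'" using 3 by (cases k) (auto simp: k_def)
    have k: "k \<le> Suc j" "Suc j + i - p = Suc k" using 3 i by (auto simp: k_def)
    have "face (W (Dec G)) (Suc p) i (twist G (Suc p) w) j =
      face G (Suc (Suc j)) (Suc k) (twist G (Suc p) w (Suc j))"
      using 3 i j by (simp add: face_W Dec k_def)
    also have "\<dots> = inv\<^bsub>L (Suc j)\<^esub> face G (Suc (Suc j)) (Suc k) (left_product G (Suc p) w (Suc (Suc j)))
      \<otimes>\<^bsub>L (Suc j)\<^esub> degen G j 0 (face G (Suc j) k (left_product G (Suc p) w (Suc j)))"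
      unfolding twist_def using y k k'
      by (simp add: face_mult face_inv face_Suc_Suc_degen_0)
    finally show ?thesis using 3 j k by (simp add: twist_def lpf k_def)
  qed
qed

text \<open>The unit inserted at \<open>j = p - i\<close> makes the new entry d_0 of the one above
  it, which is s_0(y_j); since d_0 s_0 = id, this is y_j again. So y_j is repeated, and entries
  above are degeneracies of the old ones. As for faces, one index past the end is included.\<close>

lemma left_product_degen:
  assumes w: "\<And>j. j \<le> p \<Longrightarrow> w j \<in> C j" and i: "i \<le> p"
  shows "j \<le> Suc (Suc p) \<Longrightarrow> left_product G (Suc p) (degen (W G) p i w) j =
    (if j + i \<le> p then left_product G p w j
     else degen G (j - 1) (j + i - p - 1) (left_product G p w (j - 1)))"
proof (induction "Suc (Suc p) - j" arbitrary: j)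
  case 0
  then have "j = Suc (Suc p)" by simp
  then show ?case using i by (simp add: left_product_beyond degen_one)
next
  case (Suc m)
  note y = left_product_closed[of p w, OF w]
  have j: "j \<le> Suc p" using Suc(2) by simp
  have IH: "left_product G (Suc p) (degen (W G) p i w) (Suc j) =
    (if Suc j + i \<le> p then left_product G p w (Suc j)
     else degen G j (j + i - p) (left_product G p w j))"
    using Suc(1)[of "Suc j"] Suc(2) j by simp
  note step = left_product_step[OF j, of G "degen (W G) p i w"]
  consider "j + i < p" | "j + i = p" | "p < j + i" by linarith
  then show ?case
  proof cases
    case 1
    then show ?thesis using step IH j i by (simp add: degen_W left_product_step[of j p])
  next
    case 2
    then show ?thesis using step IH j i y by (simp add: degen_W face_degen_0)
  next
    case 3
    define k where "k = j + i - p - 1"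
    obtain l where l: "j = Suc l" using 3 i by (cases j) auto
    have k: "j + i - p = Suc k" "k \<le> l" "l + i - p = k" using 3 i l by (auto simp: k_def)
    have "left_product G (Suc p) (degen (W G) p i w) j =
      face G (Suc (Suc l)) 0 (degen G (Suc l) (Suc k) (left_product G p w (Suc l))) \<otimes>\<^bsub>L (Suc l)\<^esub>
        degen G l k (w l)"
      using step IH j i 3 k(1,3) l by (simp add: degen_W)
    also have "\<dots> = degen G l k (left_product G p w l)"
      using j l k(2) y w by (simp add: face_0_degen_Suc degen_mult left_product_step[of l p])
    finally show ?thesis using 3 l k(1) by simp
  qed
qed

text \<open>The repeated entries y_j and s_0(y_j) produce the factor s_0(y_j)^(-1) s_0(y_j) = 1, the
  unit that the degeneracy has to insert. Above it, s_0 s_k = s_(k+1) s_0 supplies the shift of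
  index in \<open>Dec G\<close>.\<close>

lemma twist_degen:
  assumes w: "\<And>j. j \<le> p \<Longrightarrow> w j \<in> C j" and i: "i \<le> p" and j: "j \<le> Suc p"
  shows "twist G (Suc p) (degen (W G) p i w) j = degen (W (Dec G)) p i (twist G p w) j"
proof -
  note y = left_product_closed[of p w, OF w]
  note lpd = left_product_degen[where w=w and p=p, OF w i]
  have Dec: "level (Dec G) n = L (Suc n)" "degen (Dec G) n k = degen G (Suc n) (Suc k)" for n k
    by (simp_all add: Dec_def)
  consider "j + i < p" | "j + i = p" | "p < j + i" by linarith
  then show ?thesis
  proof cases
    case 1
    then show ?thesis using i j by (simp add: twist_def lpd degen_W)
  next
    case 2
    then show ?thesis using i j y by (simp add: twist_def lpd degen_W Dec)
  next
    case 3
    define k where "k = j + i - p - 1"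
    obtain l where l: "j = Suc l" using 3 i by (cases j) auto
    have k: "j + i - p = Suc k" "k \<le> l" using 3 i l by (auto simp: k_def)
    have "degen (W (Dec G)) p i (twist G p w) j = degen G (Suc l) (Suc k) (twist G p w l)"
      using 3 i j l k by (simp add: degen_W Dec)
    also have "\<dots> = inv\<^bsub>L (Suc (Suc l))\<^esub> degen G (Suc l) (Suc k) (left_product G p w (Suc l))
      \<otimes>\<^bsub>L (Suc (Suc l))\<^esub> degen G (Suc l) 0 (degen G l k (left_product G p w l))"
      unfolding twist_def using y k(2) by (simp add: degen_mult degen_inv degen_0_degen)
    finally show ?thesis using 3 j l k by (simp add: twist_def lpd)
  qed
qed

section \<open>Smoothness of the closed form\<close>

lemma smooth_left_product:
  fixes p :: nat
  defines "M \<equiv> level (W G) p"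
  shows "smooth_map M (mfd (L j)) (\<lambda>w. left_product G p w j)"
proof (induction "Suc p - j" arbitrary: j)
  case 0
  then show ?case
    using points_level[of j] by (simp add: left_product_beyond smooth_map_const charted_W M_def)
next
  case (Suc m)
  then have j: "j \<le> p" and IH: "smooth_map M (mfd (L (Suc j))) (\<lambda>w. left_product G p w (Suc j))"
    by simp_all
  have M: "charted M" unfolding M_def by (rule charted_W)
  have "smooth_map M (mfd (L j)) (\<lambda>w. face G (Suc j) 0 (left_product G p w (Suc j)))"
    by (rule smooth_map_compose[OF M Lie_group_charted[OF Lie] Lie_group_charted[OF Lie] IH face_smooth]) simp
  moreover have "smooth_map M (mfd (L j)) (\<lambda>w. w j)"
    unfolding M_def level_W using j Lie unfolding Lie_group_def
    by (intro smooth_map_component) auto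
  ultimately show ?case
    unfolding left_product_step[OF j] by (rule smooth_map_mult[OF Lie M])
qed

lemma smooth_twist: "smooth_map (level (W G) p) (mfd (L (Suc j))) (\<lambda>w. twist G p w j)"
  unfolding twist_def
proof (rule smooth_map_mult[OF Lie charted_W smooth_map_inv[OF Lie charted_W smooth_left_product]])
  show "smooth_map (level (W G) p) (mfd (L (Suc j))) (\<lambda>w. degen G j 0 (left_product G p w j))"
    by (rule smooth_map_compose[OF charted_W Lie_group_charted[OF Lie] Lie_group_charted[OF Lie]
          smooth_left_product degen_smooth]) simp
qed

lemma smooth_twists:
  "smooth_map (level (W G) p) (level (W (Dec G)) p) (\<lambda>w. \<lambda>j\<in>{..p}. twist G p w j)"
  unfolding level_W[of "Dec G"]
proof (rule smooth_map_into_product[OF charted_W])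
  fix j assume "j \<in> {..p}"
  then show "smooth_map (level (W G) p) (mfd (level (Dec G) j)) (\<lambda>w. (\<lambda>j\<in>{..p}. twist G p w j) j)"
    using smooth_twist[of p j] by (simp add: Dec_def)
qed simp_all

end

section \<open>First arrows and the nerve\<close>

text \<open>The edge of an \<open>(n+1)\<close>-simplex between its first two vertices, and the first vertex of an \<open>n\<close>-simplex.\<close>
primrec first_arrow :: "'x simplicial_Lie_group \<Rightarrow> nat \<Rightarrow> 'x \<Rightarrow> 'x" where
  "first_arrow G 0 x = x"
| "first_arrow G (Suc n) x = first_arrow G n (face G (Suc (Suc n)) (Suc (Suc n)) x)"

primrec first_vertex :: "'x simplicial_Lie_group \<Rightarrow> nat \<Rightarrow> 'x \<Rightarrow> 'x" where
  "first_vertex G 0 x = x"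
| "first_vertex G (Suc n) x = first_vertex G n (face G (Suc n) (Suc n) x)"

text \<open>The last face of \<open>W\<close> involves no multiplication: it applies the last face
  of \<open>K\<close> to each component and shifts the index down by one. After \<open>n\<close>
  steps the two surviving components stem from the two top ones.\<close>

lemma faces_to_1_components:
  "faces_to_1 K n w 1 = first_arrow K n (w (Suc n))" "faces_to_1 K n w 0 = first_vertex K n (w n)"
proof (induction n arbitrary: w)
  case (Suc n)
  { case 1 show ?case using Suc(1) by (simp add: face_W) }
  { case 2 show ?case using Suc(2) by (simp add: face_W) }
qed simp_all

lemma eps_arrow_eq:
  assumes "p = Suc n"
  shows "eps_arrow K p w =
    inv\<^bsub>level K 1\<^esub> first_arrow K n (w p) \<otimes>\<^bsub>level K 1\<^esub>
      degen K 0 0 (face K 1 0 (first_arrow K n (w p))) \<otimes>\<^bsub>level K 1\<^esub>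
      degen K 0 0 (first_vertex K n (w n))"
  using assms by (simp add: eps_arrow_def eps1_def Wbar_def faces_to_1_components[simplified])

context simplicial_Lie_group_loc
begin

lemma first_arrow_group_hom: "group_hom (L (Suc n)) (L (Suc 0)) (first_arrow G n)"
proof (induction n)
  case (Suc n)
  interpret group_hom "L (Suc n)" "L (Suc 0)" "first_arrow G n" by (rule Suc)
  show ?case
    by (intro group_hom.intro group_hom_axioms.intro is_group homI) (simp_all add: face_mult)
qed (intro group_hom.intro group_hom_axioms.intro is_group homI, simp_all)

lemma first_vertex_group_hom: "group_hom (L n) (L 0) (first_vertex G n)"
proof (induction n)
  case (Suc n)
  interpret group_hom "L n" "L 0" "first_vertex G n" by (rule Suc)
  show ?case
    by (intro group_hom.intro group_hom_axioms.intro is_group homI) (simp_all add: face_mult)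
qed (intro group_hom.intro group_hom_axioms.intro is_group homI, simp_all)

text \<open>The zeroth degeneracy doubles the initial vertex, so the first edge is the unit
  there.\<close>

lemma first_arrow_degen:
  "x \<in> C n \<Longrightarrow> first_arrow G n (degen G n 0 x) = degen G 0 0 (first_vertex G n x)"
  by (induction n arbitrary: x) (simp_all add: face_Suc_Suc_degen_0)

text \<open>Deleting the initial vertex makes the second vertex the first one, and that is the
  source of the first arrow.\<close>

lemma first_vertex_face_0:
  "x \<in> C (Suc n) \<Longrightarrow> first_vertex G n (face G (Suc n) 0 x) = face G (Suc 0) 0 (first_arrow G n x)"
  by (induction n arbitrary: x) (simp_all add: face_0_face_Suc[symmetric])

text \<open>At the position below the top, y_(n+1) = w_(n+1) and y_n = d_0(w_(n+1)) w_n. With a the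
  first arrow of w_(n+1) and v the first vertex of w_n, the homomorphism property yields a^(-1)
  s_0(d_0(a) v), which is the formula of \<open>eps1\<close>.\<close>

lemma first_arrow_twist:
  assumes "\<And>j. j \<le> Suc n \<Longrightarrow> w j \<in> C j"
  shows "first_arrow G n (twist G (Suc n) w n) = eps_arrow G (Suc n) w"
proof -
  note w = assms[of n] assms[of "Suc n"]
  interpret fa: group_hom "L (Suc n)" "L (Suc 0)" "first_arrow G n" by (rule first_arrow_group_hom)
  interpret fv: group_hom "L n" "L 0" "first_vertex G n" by (rule first_vertex_group_hom)
  have fw: "first_arrow G n (w (Suc n)) \<in> C (Suc 0)" "first_vertex G n (w n) \<in> C 0"
    using w fa.hom_closed fv.hom_closed by auto
  have "first_arrow G n (twist G (Suc n) w n) =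
      inv\<^bsub>L (Suc 0)\<^esub> first_arrow G n (w (Suc n)) \<otimes>\<^bsub>L (Suc 0)\<^esub>
        degen G 0 0 (first_vertex G n (face G (Suc n) 0 (w (Suc n)) \<otimes>\<^bsub>L n\<^esub> w n))"
    using w by (simp add: twist_def left_product_top left_product_step[of n] first_arrow_degen)
  also have "first_vertex G n (face G (Suc n) 0 (w (Suc n)) \<otimes>\<^bsub>L n\<^esub> w n) =
      face G (Suc 0) 0 (first_arrow G n (w (Suc n))) \<otimes>\<^bsub>L 0\<^esub> first_vertex G n (w n)"
    using w by (simp add: first_vertex_face_0)
  finally show ?thesis
    using fw by (simp add: eps_arrow_eq degen_mult m_assoc)
qed

end

section \<open>Simplices of the nerve as tuples of arrows\<close>

locale strict_Lie_2_group_loc =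
  fixes G :: "'x simplicial_Lie_group" and gmult tup
  assumes strict_Lie_2_group: "strict_Lie_2_group G gmult tup"
begin

sublocale simplicial_Lie_group_loc G
  using strict_Lie_2_group unfolding strict_Lie_2_group_def by unfold_locales blast

lemma nerve: "is_nerve (underlying_manifold G) gmult tup"
  using strict_Lie_2_group unfolding strict_Lie_2_group_def by blast

lemma tup_arrow: "x \<in> C (Suc 0) \<Longrightarrow> tup (Suc 0) x (Suc 0) = x"
  using nerve unfolding is_nerve_def underlying_manifold_def by (simp add: points_level)

lemma tup_composable:
  assumes "x \<in> C (Suc n)"
  shows "tup (Suc n) x \<in> composable (C 1) (face G 1 0) (face G 1 1) (Suc n)"
proof -
  have "tup (Suc n) ` C (Suc n) = composable (C 1) (face G 1 0) (face G 1 1) (Suc n)"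
    using nerve unfolding is_nerve_def underlying_manifold_def by (simp add: points_level)
  then show ?thesis using assms by blast
qed

lemma tup_inj: "inj_on (tup (Suc n)) (C (Suc n))"
proof -
  have "submanifold_embedding (mfd (L (Suc n))) (product_manifold {1..Suc n} (\<lambda>_. mfd (L (Suc 0)))) (tup (Suc n))"
    using nerve unfolding is_nerve_def underlying_manifold_def by simp
  then have "embedding_map (mtop (mfd (L (Suc n))))
      (mtop (product_manifold {1..Suc n} (\<lambda>_. mfd (L (Suc 0))))) (tup (Suc n))"
    unfolding submanifold_embedding_def by blast
  then have "inj_on (tup (Suc n)) (points (mfd (L (Suc n))))"
    unfolding embedding_map_def by (rule homeomorphic_imp_injective_map)
  then show ?thesis by (simp only: points_level)
qed

lemma tup_face:
  assumes "x \<in> C (Suc (Suc n))" "i \<in> {1..Suc n}"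
  shows "tup (Suc n) (face G (Suc (Suc n)) 0 x) i = tup (Suc (Suc n)) x (Suc i)"
    and "tup (Suc n) (face G (Suc (Suc n)) (Suc (Suc n)) x) i = tup (Suc (Suc n)) x i"
proof -
  have "\<forall>n\<ge>2. \<forall>x\<in>C n.
      tup (n - 1) (face G n 0 x) = (\<lambda>i\<in>{1..n - 1}. tup n x (i + 1)) \<and>
      tup (n - 1) (face G n n x) = (\<lambda>i\<in>{1..n - 1}. tup n x i)"
    using nerve unfolding is_nerve_def underlying_manifold_def by (simp add: points_level)
  from this[rule_format, of "Suc (Suc n)" x] assms
  show "tup (Suc n) (face G (Suc (Suc n)) 0 x) i = tup (Suc (Suc n)) x (Suc i)"
    and "tup (Suc n) (face G (Suc (Suc n)) (Suc (Suc n)) x) i = tup (Suc (Suc n)) x i"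
    by simp_all
qed

text \<open>Each last face drops the last arrow of the tuple, until only the first is left.\<close>

lemma tup_first: "x \<in> C (Suc n) \<Longrightarrow> tup (Suc n) x (Suc 0) = first_arrow G n x"
proof (induction n arbitrary: x)
  case 0
  then show ?case by (simp add: tup_arrow)
next
  case (Suc n)
  then show ?case using tup_face(2)[of x n "Suc 0"] by simp
qed

lemma tup_twist:
  assumes "\<And>j. j \<le> Suc (Suc n) \<Longrightarrow> w j \<in> C j"
  shows "tup (Suc (Suc n)) (twist G (Suc (Suc n)) w (Suc n)) =
    tuple_cons (Suc (Suc n)) (eps_arrow G (Suc (Suc n)) w) (tup (Suc n) (w (Suc n)))"
proof
  fix i
  let ?z = "twist G (Suc (Suc n)) w (Suc n)"
  have z: "?z \<in> C (Suc (Suc n))" using assms by (rule twist_closed)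
  have w: "face G (Suc (Suc n)) 0 ?z = w (Suc n)" using assms by (rule face_0_twist) simp_all
  consider "i \<notin> {1..Suc (Suc n)}" | "i = Suc 0" | l where "i = Suc l" "l \<in> {1..Suc n}"
    by (cases i) force+
  then show "tup (Suc (Suc n)) ?z i =
      tuple_cons (Suc (Suc n)) (eps_arrow G (Suc (Suc n)) w) (tup (Suc n) (w (Suc n))) i"
  proof cases
    case 1
    \<comment> \<open>Off the index range both functions are \<open>undefined\<close>: the left one
      as an extensional tuple, the right one by its restriction.\<close>
    have "tup (Suc (Suc n)) ?z \<in> extensional {1..Suc (Suc n)}"
      using tup_composable[OF z] unfolding composable_def by (simp add: PiE_def)
    then have "tup (Suc (Suc n)) ?z i = undefined" using 1 by (rule extensional_arb)
    then show ?thesis unfolding tuple_cons_def restrict_apply using 1 by (simp only: if_False)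
  next
    case 2
    then show ?thesis
      using tup_first[OF z] first_arrow_twist[of "Suc n" w, OF assms] by (simp add: tuple_cons_def)
  next
    case 3
    then show ?thesis
      using tup_face(1)[OF z 3(2)] w by (simp add: tuple_cons_def)
  qed
qed

lemma cons_simplex_eq_twist:
  assumes "\<And>j. j \<le> Suc (Suc n) \<Longrightarrow> w j \<in> C j"
  shows "cons_simplex G tup (Suc (Suc n)) (eps_arrow G (Suc (Suc n)) w) (w (Suc n)) =
    twist G (Suc (Suc n)) w (Suc n)"
proof -
  have "inv_into (C (Suc (Suc n))) (tup (Suc (Suc n))) (tup (Suc (Suc n)) (twist G (Suc (Suc n)) w (Suc n))) =
      twist G (Suc (Suc n)) w (Suc n)"
    using assms by (intro inv_into_f_f tup_inj twist_closed)
  then show ?thesis using assms by (simp add: cons_simplex_def tup_twist)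
qed

section \<open>The recursive map equals the closed form\<close>

lemma eps1_eq_twist:
  assumes "\<And>j. j \<le> 1 \<Longrightarrow> w j \<in> C j"
  shows "eps1 G w = (\<lambda>j\<in>{..1}. twist G 1 w j)"
proof
  fix j :: nat
  have w: "w 0 \<in> C 0" "w (Suc 0) \<in> C (Suc 0)" using assms by auto
  consider "j = 0" | "j = 1" | "1 < j" by linarith
  then show "eps1 G w j = (\<lambda>j\<in>{..1}. twist G 1 w j) j"
  proof cases
    case 1
    then show ?thesis
      using w by (simp add: eps1_def twist_def left_product_top left_product_step[of 0] degen_mult m_assoc)
  next
    case 2
    then show ?thesis using w by (simp add: eps1_def twist_top)
  qed (simp add: eps1_def)
qed

text \<open>The zeroth face of \<open>W\<close> keeps y_0, ..., y_(p-1) but replaces y_p = w_p by 1.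
  Component \<open>j\<close> depends on y_j and y_(j+1), so the induction hypothesis is right for
  \<open>j \<le> p - 2\<close> and wrong at \<open>p - 1\<close>: this is the component that the
  recursion discards and replaces by the pair.\<close>

lemma eps_eq_twist:
  assumes "\<And>j. j \<le> p \<Longrightarrow> w j \<in> C j"
  shows "eps G tup p w = (\<lambda>j\<in>{..p}. twist G p w j)"
  using assms
proof (induction p arbitrary: w rule: less_induct)
  case (less p)
  consider "p = 0" | "p = 1" | q where "p = Suc (Suc q)" by (metis One_nat_def not0_implies_Suc)
  then show ?case
  proof cases
    case 1
    then show ?thesis using less(2)[of 0] by (auto simp: twist_top)
  next
    case 2
    then show ?thesis using eps1_eq_twist[of w] less(2) by simp
  next
    case (3 q)
    let ?w = "face (W G) (Suc (Suc q)) 0 w"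
    have w: "\<And>j. j \<le> Suc (Suc q) \<Longrightarrow> w j \<in> C j" using less(2) unfolding 3 .
    have w': "?w j \<in> C j" if "j \<le> Suc q" for j
      by (rule face_W_closed[OF w _ that]) simp_all
    have IH: "eps G tup (Suc q) ?w = (\<lambda>j\<in>{..Suc q}. twist G (Suc q) ?w j)"
      by (rule less(1)[OF _ w']) (simp_all add: 3)
    \<comment> \<open>For \<open>j \<le> q\<close> both indices \<open>j\<close> and
      \<open>Suc j\<close> are at most \<open>Suc q\<close>, where the face with
      \<open>i = 0\<close> leaves the sequence unchanged.\<close>
    have low: "twist G (Suc q) ?w j = twist G (Suc (Suc q)) w j" if "j \<le> q" for j
      using that left_product_face[where w=w and p="Suc q" and i=0, OF w] by (simp add: twist_def)
    show ?thesis
    proof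
      fix j
      consider "j \<le> q" | "j = Suc q" | "j = Suc (Suc q)" | "Suc (Suc q) < j" by linarith
      then show "eps G tup p w j = (\<lambda>j\<in>{..p}. twist G p w j) j"
      proof cases
        case 1
        then show ?thesis using IH low[OF 1] unfolding 3 by (simp add: Wbar_def)
      next
        case 2
        then show ?thesis using cons_simplex_eq_twist[of q w, OF w] unfolding 3 by simp
      next
        case 3
        then show ?thesis using \<open>p = _\<close> w twist_top[of w "Suc (Suc q)"] by simp
      next
        case 4
        then show ?thesis using \<open>p = _\<close> by simp
      qed
    qed
  qed
qed

section \<open>Well-definedness, compatibility with the simplicial structure, splitting\<close>

lemma points_W_D: "w \<in> points (level (W G) p) \<Longrightarrow> j \<le> p \<Longrightarrow> w j \<in> C j"
  unfolding points_W points_level by (auto dest: PiE_mem)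

text \<open>Sources and targets are not compared directly: the pair is the tuple of an actual
  simplex, given by \<open>twist\<close>, and such tuples are composable.\<close>

lemma tuple_cons_eps_arrow_composable:
  assumes "2 \<le> p" "w \<in> points (level (W G) p)"
  shows "tuple_cons p (eps_arrow G p w) (tup (p - 1) (w (p - 1)))
    \<in> composable (C 1) (face G 1 0) (face G 1 1) p"
proof -
  obtain n where p: "p = Suc (Suc n)" using assms(1) by (cases p; cases "p - 1") auto
  have w: "\<And>j. j \<le> Suc (Suc n) \<Longrightarrow> w j \<in> C j" using points_W_D[OF assms(2)] unfolding p .
  show ?thesis
    using tup_composable[of "twist G (Suc (Suc n)) w (Suc n)" "Suc n"] w
    by (simp add: p tup_twist twist_closed)
qed

lemma charted_W_Dec: "charted (level (W (Dec G)) p)"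
  unfolding level_W by (intro charted_product_manifold) (simp_all add: Dec_def Lie_group_charted[OF Lie])

lemma eps_simplicial: "simplicial_map (W G) (W (Dec G)) (eps G tup)"
  unfolding simplicial_map_def
proof (intro conjI allI ballI impI)
  show "smooth_map (level (W G) p) (level (W (Dec G)) p) (eps G tup p)" for p
    by (rule smooth_map_cong[OF charted_W charted_W_Dec _ smooth_twists])
       (simp add: eps_eq_twist points_W_D)
next
  fix p i w assume w: "w \<in> points (level (W G) (p + 1))" and i: "i \<le> p + 1"
  have wC: "\<And>j. j \<le> Suc p \<Longrightarrow> w j \<in> C j" using points_W_D[OF w] by simp
  have "eps G tup p (face (W G) (Suc p) i w) = (\<lambda>j\<in>{..p}. twist G p (face (W G) (Suc p) i w) j)"
    by (rule eps_eq_twist, rule face_W_closed[OF wC]) (use i in simp_all)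
  also have "\<dots> = face (W (Dec G)) (Suc p) i (\<lambda>j\<in>{..Suc p}. twist G (Suc p) w j)"
  proof (rule extensionalityI[OF _ face_W_extensional])
    fix j assume "j \<in> {..p}"
    then show "(\<lambda>j\<in>{..p}. twist G p (face (W G) (Suc p) i w) j) j =
        face (W (Dec G)) (Suc p) i (\<lambda>j\<in>{..Suc p}. twist G (Suc p) w j) j"
      using twist_face[of p w i j, OF wC] i by (simp add: face_W)
  qed simp
  also have "(\<lambda>j\<in>{..Suc p}. twist G (Suc p) w j) = eps G tup (Suc p) w"
    by (rule eps_eq_twist[OF wC, symmetric])
  finally show "eps G tup p (face (W G) (p + 1) i w) = face (W (Dec G)) (p + 1) i (eps G tup (p + 1) w)"
    by simp
next
  fix p i w assume w: "w \<in> points (level (W G) p)" and i: "i \<le> p"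
  note wC = points_W_D[OF w]
  have "degen (W G) p i w j \<in> C j" if "j \<le> Suc p" for j
  proof -
    consider "j + i < p" | "j + i = p" | l where "p < j + i" "j = Suc l" using i by (cases j) force+
    then show ?thesis
    proof cases
      case 3
      then show ?thesis using that i wC[of l] by (simp add: degen_W)
    qed (use that i wC in \<open>simp_all add: degen_W\<close>)
  qed
  then have "eps G tup (Suc p) (degen (W G) p i w) =
      (\<lambda>j\<in>{..Suc p}. twist G (Suc p) (degen (W G) p i w) j)"
    by (rule eps_eq_twist)
  also have "\<dots> = degen (W (Dec G)) p i (\<lambda>j\<in>{..p}. twist G p w j)"
  proof (rule extensionalityI[OF _ degen_W_extensional])
    fix j assume j: "j \<in> {..Suc p}"
    \<comment> \<open>The degeneracy reads entry \<open>j\<close> only if \<open>j + i < p\<close>,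
      and entry \<open>j - 1\<close> only if \<open>j + i > p\<close>. Both indices are at most
      \<open>p\<close>, so the restriction to \<open>{..p}\<close> is invisible to it.\<close>
    then have "j + i \<le> p \<or> j - 1 \<le> p" "j + i \<le> p \<longrightarrow> j \<le> p" by auto
    with j show "(\<lambda>j\<in>{..Suc p}. twist G (Suc p) (degen (W G) p i w) j) j =
        degen (W (Dec G)) p i (\<lambda>j\<in>{..p}. twist G p w j) j"
      using twist_degen[of p w i j, OF wC i] i by (auto simp: degen_W)
  qed simp
  also have "(\<lambda>j\<in>{..p}. twist G p w j) = eps G tup p w"
    by (rule eps_eq_twist[OF wC, symmetric])
  finally show "eps G tup (p + 1) (degen (W G) p i w) = degen (W (Dec G)) p i (eps G tup p w)"
    by simp
qed

lemma eps_splitting: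
  assumes "w \<in> points (level (W G) p)"
  shows "W_map (Dec_d0 G) p (eps G tup p w) = w"
proof (rule extensionalityI[where A="{..p}"])
  note wC = points_W_D[OF assms]
  show "w \<in> extensional {..p}" using assms unfolding points_W by (simp add: PiE_def)
  fix j assume "j \<in> {..p}"
  then show "W_map (Dec_d0 G) p (eps G tup p w) j = w j"
    using face_0_twist[of p w j, OF wC] by (simp add: W_map_def Dec_d0_def eps_eq_twist[OF wC])
qed (simp add: W_map_def)

end

theorem proposition3p2:
  fixes G :: "'x simplicial_Lie_group"
    and gmult :: "'x \<Rightarrow> 'x \<Rightarrow> 'x"
    and tup :: "nat \<Rightarrow> 'x \<Rightarrow> nat \<Rightarrow> 'x"
  assumes "strict_Lie_2_group G gmult tup"
  shows "(\<forall>p\<ge>2. \<forall>w\<in>points (level (W G) p).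
            tuple_cons p (eps_arrow G p w) (tup (p - 1) (w (p - 1)))
              \<in> composable (carrier (level G 1)) (face G 1 0) (face G 1 1) p) \<and>
         simplicial_map (W G) (W (Dec G)) (eps G tup) \<and>
         (\<forall>p. \<forall>w\<in>points (level (W G) p). W_map (Dec_d0 G) p (eps G tup p w) = w)"
proof -
  interpret strict_Lie_2_group_loc G gmult tup by unfold_locales (rule assms)
  show ?thesis
    using tuple_cons_eps_arrow_composable eps_simplicial eps_splitting by blast
qed

end
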